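(* Let $\Omega\subset\mathbb{R}^d$ be a bounded Lipschitz domain and $0<T<\infty$. Let $A\in C^1(\mathbb{R}^d)$ be such that, for constants $C_A,\overline{C}_A>0$, $(A'(p)-A'(q),p-q)\ge C_A|p-q|^2$ and $|A'(p)|\le\overline{C}_A|p|$ for all $p,q\in\mathbb{R}^d$. Let $\psi\in C^1(\mathbb{R})$ be bounded from below, and suppose there are constants $c,C_\psi\ge0$, $C_n\ge0$ $(n\in\mathbb{N})$ and functions $f_n\in C^2(\mathbb{R})$ with $f_n\to\psi$ in $C^1_{\mathrm{loc}}(\mathbb{R})$, $-c\le f_n\le c(\psi+1)$, $f_n''\ge-C_\psi$ and $|f_n''|\le C_n$ on $\mathbb{R}$. Let $\tau=\max_j\tau_j\le\tfrac1{1+2C_\psi}$. Then the mapping $\tilde S_\tau:(y_0,u_\tau)\mapsto y_\tau$, defined for $u_\tau\in U_\tau$ and $y_0\in H^1(\Omega)$ with $\psi(y_0)\in L^1(\Omega)$, where $y_\tau\in Y_\tau$ is the solution of $$(y_j,\varphi)+\tau_j(A'(\nabla y_j),\nabla\varphi)+\tau_j(\psi'(y_j),\varphi)=\tau_j(u_j,\varphi)+(y_{j-1},\varphi)\qquad\forall\varphi\in H^1(\Omega),\ j=1,\dots,N,$$ with $y_\tau(0,\cdot)=y_0$, is Lipschitz-continuous in the sense that there is a constant $C_{A,\psi,T}$, independent of $\tau$, such that for $y_\tau^{(i)}=\tilde S_\tau(y_0^{(i)},u_\tau^{(i)})$, $i=1,2$, $$\|y_\tau^{(1)}-y_\tau^{(2)}\|_{L^\infty(0,T;L^2(\Omega))}+\|\nabla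 y_\tau^{(1)}-\nabla y_\tau^{(2)}\|_{L^2(0,T;L^2(\Omega))}\le C_{A,\psi,T}\Big(\|y_0^{(1)}-y_0^{(2)}\|_{L^2(\Omega)}+\|u_\tau^{(1)}-u_\tau^{(2)}\|_{L^2(0,T;H^1(\Omega)')}\Big).$$
   Context: $A'$ denotes the gradient of $A$; $(\cdot,\cdot)$ is the $L^2(\Omega)$ (or Euclidean) scalar product; $H^1(\Omega)'$ is the dual space of $H^1(\Omega)$, with $L^2(\Omega)\hookrightarrow H^1(\Omega)'$ via the $L^2$ scalar product. Time discretization: for $0=t_0<t_1<\dots<t_N=T$ put $I_j=(t_{j-1},t_j]$, $\tau_j=t_j-t_{j-1}$, $\tau=\max_j\tau_j$. With $Q=[0,T]\times\Omega$, $Y_\tau$ is the set of $y_\tau:Q\to\mathbb{R}$ with $y_\tau(t,\cdot)\in H^1(\Omega)$ for all $t$ and $y_\tau(\cdot,x)$ constant on each $I_j$ (for a.e. $x$); $U_\tau$ is the set of $u_\tau:Q\to\mathbb{R}$ with $u_\tau(t,\cdot)\in L^2(\Omega)$ for all $t$ and $u_\tau(\cdot,x)$ constant on each $I_j$ (for a.e. $x$). One writes $y_j:=y_{\tau|I_j}$, $u_j:=u_{\tau|I_j}$, and $y_0=y_\tau(0,\cdot)$. Under the stated assumptions the displayed discrete equation has a unique solution in $Y_\tau$, so $\tilde S_\tau$ is well defined. *)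

theory Defs
  imports "HOL-Analysis.Analysis" "HOL-Probability.Essential_Supremum"
begin

section \<open>Bounded Lipschitz domains\<close>

text \<open>
  Near every boundary point, after a choice of a unit direction \<open>e\<close>, the set lies strictly below
  the graph of a Lipschitz function \<open>\<gamma>\<close> on the hyperplane orthogonal to \<open>e\<close>; the vector
  \<open>x - (x \<bullet> e) *\<^sub>R e\<close> is the orthogonal projection of \<open>x\<close> to that hyperplane.
\<close>

definition bounded_lipschitz_domain :: "'a::euclidean_space set \<Rightarrow> bool" where
  "bounded_lipschitz_domain \<Omega> \<longleftrightarrow>
     open \<Omega> \<and> connected \<Omega> \<and> \<Omega> \<noteq> {} \<and> bounded \<Omega> \<and>
     (\<forall>p\<in>frontier \<Omega>. \<exists>V e (\<gamma> :: 'a \<Rightarrow> real) L.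
        open V \<and> p \<in> V \<and> norm e = 1 \<and> L-lipschitz_on {z. z \<bullet> e = 0} \<gamma> \<and>
        \<Omega> \<inter> V = {x \<in> V. x \<bullet> e < \<gamma> (x - (x \<bullet> e) *\<^sub>R e)})"


section \<open>The spaces \<open>L\<^sup>2(\<Omega>)\<close>, \<open>H\<^sup>1(\<Omega>)\<close> and the dual of \<open>H\<^sup>1(\<Omega>)\<close>\<close>

text \<open>
  Elements of these spaces are represented by functions on the whole ambient space, of which only
  the values on \<open>\<Omega>\<close> matter; no passage to classes modulo null sets is made.
\<close>

definition L2 :: "'a::euclidean_space set \<Rightarrow> ('a \<Rightarrow> 'b::euclidean_space) set" where
  "L2 \<Omega> = {f \<in> borel_measurable (lebesgue_on \<Omega>). integrable (lebesgue_on \<Omega>) (\<lambda>x. (norm (f x))\<^sup>2)}"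

definition L2_inner ::
    "'a::euclidean_space set \<Rightarrow> ('a \<Rightarrow> 'b::euclidean_space) \<Rightarrow> ('a \<Rightarrow> 'b) \<Rightarrow> real" where
  "L2_inner \<Omega> f g = (LINT x|lebesgue_on \<Omega>. f x \<bullet> g x)"

definition L2_norm :: "'a::euclidean_space set \<Rightarrow> ('a \<Rightarrow> 'b::euclidean_space) \<Rightarrow> real" where
  "L2_norm \<Omega> f = sqrt (LINT x|lebesgue_on \<Omega>. (norm (f x))\<^sup>2)"

primrec C_k :: "nat \<Rightarrow> ('a::euclidean_space \<Rightarrow> real) \<Rightarrow> bool" where
  "C_k 0 f \<longleftrightarrow> continuous_on UNIV f"
| "C_k (Suc k) f \<longleftrightarrow>
     (\<forall>x. f differentiable (at x)) \<and> (\<forall>i\<in>Basis. C_k k (\<lambda>x. frechet_derivative f (at x) i))"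

definition test_function :: "'a::euclidean_space set \<Rightarrow> ('a \<Rightarrow> real) \<Rightarrow> bool" where
  "test_function \<Omega> \<phi> \<longleftrightarrow>
     (\<forall>k. C_k k \<phi>) \<and> (\<exists>K. compact K \<and> K \<subseteq> \<Omega> \<and> (\<forall>x. x \<notin> K \<longrightarrow> \<phi> x = 0))"

text \<open>
  The following relation is used only for \<open>f\<close> and \<open>g\<close> in \<open>L2 \<Omega>\<close>, for which both integrals exist.
\<close>

definition has_weak_gradient ::
    "'a::euclidean_space set \<Rightarrow> ('a \<Rightarrow> real) \<Rightarrow> ('a \<Rightarrow> 'a) \<Rightarrow> bool" where
  "has_weak_gradient \<Omega> f g \<longleftrightarrow>
     (\<forall>\<phi>. test_function \<Omega> \<phi> \<longrightarrow>
       (\<forall>i\<in>Basis. (LINT x|lebesgue_on \<Omega>. f x * frechet_derivative \<phi> (at x) i)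
                  = - (LINT x|lebesgue_on \<Omega>. (g x \<bullet> i) * \<phi> x)))"

definition H1 :: "'a::euclidean_space set \<Rightarrow> ('a \<Rightarrow> real) set" where
  "H1 \<Omega> = {f \<in> L2 \<Omega>. \<exists>g\<in>L2 \<Omega>. has_weak_gradient \<Omega> f g}"

text \<open>The weak gradient is unique up to null sets, so the choice is immaterial.\<close>

definition weak_grad :: "'a::euclidean_space set \<Rightarrow> ('a \<Rightarrow> real) \<Rightarrow> 'a \<Rightarrow> 'a" where
  "weak_grad \<Omega> f = (SOME g. g \<in> L2 \<Omega> \<and> has_weak_gradient \<Omega> f g)"

definition H1_norm :: "'a::euclidean_space set \<Rightarrow> ('a \<Rightarrow> real) \<Rightarrow> real" where
  "H1_norm \<Omega> f = sqrt ((L2_norm \<Omega> f)\<^sup>2 + (L2_norm \<Omega> (weak_grad \<Omega> f))\<^sup>2)"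

definition H1_dual_norm :: "'a::euclidean_space set \<Rightarrow> (('a \<Rightarrow> real) \<Rightarrow> real) \<Rightarrow> real" where
  "H1_dual_norm \<Omega> F = (SUP \<phi>\<in>{\<phi> \<in> H1 \<Omega>. H1_norm \<Omega> \<phi> \<le> 1}. \<bar>F \<phi>\<bar>)"

text \<open>
  With this, \<open>L2_inner \<Omega> v\<close> is the functional on \<open>H\<^sup>1(\<Omega>)\<close> that is identified with \<open>v \<in> L\<^sup>2(\<Omega>)\<close>.
\<close>


section \<open>Norms in time\<close>

text \<open>
  The norms of \<open>L\<^sup>\<infinity>(0,T;X)\<close> and \<open>L\<^sup>2(0,T;X)\<close> of a function with \<open>X\<close>-norm \<open>h s\<close> at time \<open>s\<close>.
  The first is an extended real, so that it is meaningful without a boundedness proviso; the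
  second is applied only to step functions, whose squares are integrable.
\<close>

definition Linf_time_norm :: "real \<Rightarrow> (real \<Rightarrow> real) \<Rightarrow> ereal" where
  "Linf_time_norm T h = esssup (lebesgue_on {0..T}) (\<lambda>s. ereal (h s))"

definition L2_time_norm :: "real \<Rightarrow> (real \<Rightarrow> real) \<Rightarrow> real" where
  "L2_time_norm T h = sqrt (LINT s|lebesgue_on {0..T}. (h s)\<^sup>2)"


section \<open>Time discretization\<close>

definition time_grid :: "real \<Rightarrow> nat \<Rightarrow> (nat \<Rightarrow> real) \<Rightarrow> bool" where
  "time_grid T N t \<longleftrightarrow> t 0 = 0 \<and> t N = T \<and> (\<forall>j\<in>{1..N}. t (j - 1) < t j)"

definition time_step :: "(nat \<Rightarrow> real) \<Rightarrow> nat \<Rightarrow> real" where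
  "time_step t j = t j - t (j - 1)"

definition max_step :: "nat \<Rightarrow> (nat \<Rightarrow> real) \<Rightarrow> real" where
  "max_step N t = Max (time_step t ` {1..N})"

definition Y_space ::
    "'a::euclidean_space set \<Rightarrow> real \<Rightarrow> nat \<Rightarrow> (nat \<Rightarrow> real) \<Rightarrow> (real \<Rightarrow> 'a \<Rightarrow> real) set" where
  "Y_space \<Omega> T N t =
     {y. (\<forall>s\<in>{0..T}. y s \<in> H1 \<Omega>) \<and>
         (AE x in lebesgue_on \<Omega>. \<forall>j\<in>{1..N}. (\<lambda>s. y s x) constant_on {t (j - 1)<..t j})}"

definition U_space ::
    "'a::euclidean_space set \<Rightarrow> real \<Rightarrow> nat \<Rightarrow> (nat \<Rightarrow> real) \<Rightarrow> (real \<Rightarrow> 'a \<Rightarrow> real) set" where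
  "U_space \<Omega> T N t =
     {u. (\<forall>s\<in>{0..T}. u s \<in> L2 \<Omega>) \<and>
         (AE x in lebesgue_on \<Omega>. \<forall>j\<in>{1..N}. (\<lambda>s. u s x) constant_on {t (j - 1)<..t j})}"

text \<open>
  The graph of the solution operator: \<open>y = S(y\<^sub>0, u)\<close>, with equality of functions on \<open>\<Omega>\<close> modulo null
  sets. The value on the interval \<open>I\<^sub>j\<close> is read off at its right end point \<open>t j\<close>. As \<open>\<psi>'(y\<^sub>j)\<close> is not
  known in advance to be square integrable, only the existence of the integral of \<open>\<psi>'(y\<^sub>j) \<phi>\<close> is
  demanded; the other integrands are products of \<open>L\<^sup>2\<close> functions.
\<close>

definition S_tau_graph ::
    "'a::euclidean_space set \<Rightarrow> ('a \<Rightarrow> 'a) \<Rightarrow> (real \<Rightarrow> real) \<Rightarrow> real \<Rightarrow> nat \<Rightarrow> (nat \<Rightarrow> real) \<Rightarrow>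
     ('a \<Rightarrow> real) \<Rightarrow> (real \<Rightarrow> 'a \<Rightarrow> real) \<Rightarrow> (real \<Rightarrow> 'a \<Rightarrow> real) \<Rightarrow> bool" where
  "S_tau_graph \<Omega> A' \<psi>' T N t y\<^sub>0 u y \<longleftrightarrow>
     y \<in> Y_space \<Omega> T N t \<and>
     (AE x in lebesgue_on \<Omega>. y 0 x = y\<^sub>0 x) \<and>
     (\<forall>j\<in>{1..N}. \<forall>\<phi>\<in>H1 \<Omega>.
        integrable (lebesgue_on \<Omega>) (\<lambda>x. \<psi>' (y (t j) x) * \<phi> x) \<and>
        L2_inner \<Omega> (y (t j)) \<phi>
          + time_step t j * L2_inner \<Omega> (\<lambda>x. A' (weak_grad \<Omega> (y (t j)) x)) (weak_grad \<Omega> \<phi>)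
          + time_step t j * L2_inner \<Omega> (\<lambda>x. \<psi>' (y (t j) x)) \<phi>
        = time_step t j * L2_inner \<Omega> (u (t j)) \<phi> + L2_inner \<Omega> (y (t (j - 1))) \<phi>)"

end

theory Submission
  imports Defs
begin

text \<open>
  The difference \<open>e\<^sub>j\<close> of two solutions is an admissible test function in the difference of their
  equations. Strong monotonicity of \<open>A'\<close> controls the gradient of \<open>e\<^sub>j\<close>, and \<open>\<psi>' + C\<^sub>\<psi> id\<close> is monotone
  because it is the pointwise limit of the functions \<open>f\<^sub>n' + C\<^sub>\<psi> id\<close>, which are monotone as
  \<open>f\<^sub>n'' \<ge> - C\<^sub>\<psi>\<close>. Absorbing the \<open>H\<^sup>1\<close>-norm of \<open>e\<^sub>j\<close> from the duality pairing with a small weight \<open>\<delta>\<close> gives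
  \<open>(1 - (2 C\<^sub>\<psi> + \<delta>) \<tau>\<^sub>j) \<parallel>e\<^sub>j\<parallel>\<^sup>2 + C\<^sub>A \<tau>\<^sub>j \<parallel>\<nabla>e\<^sub>j\<parallel>\<^sup>2 \<le> \<parallel>e\<^sub>j\<^sub>-\<^sub>1\<parallel>\<^sup>2 + \<tau>\<^sub>j \<parallel>w\<^sub>j\<parallel>\<^sup>2 / \<delta>\<close>, where \<open>w\<^sub>j\<close> is the difference of
  the controls. For \<open>\<delta> < 1\<close> the bound on the step size keeps the first factor away from zero, and a discrete
  Gronwall argument concludes.

  Testing with \<open>e\<^sub>j\<close> needs \<open>\<nabla>e\<^sub>j = \<nabla>y\<^sub>1\<^sub>j - \<nabla>y\<^sub>2\<^sub>j\<close>, that is, uniqueness of weak gradients. It follows from the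
  fundamental lemma of the calculus of variations, with products of one-dimensional bump functions
  \<open>exp (- 1 / s)\<close> that converge to indicators of boxes.
\<close>


section \<open>Smooth bump functions on boxes\<close>

text \<open>For n = 0 this is the classical smooth function exp (- 1 / s), extended by 0. The powers
  of 1 / s make the family closed under differentiation up to linear combinations.\<close>

definition exp_bump :: "nat \<Rightarrow> real \<Rightarrow> real" where
  "exp_bump n s = (if s > 0 then (1 / s) ^ n * exp (- 1 / s) else 0)"

text \<open>From the right, r = 1 / s turns the expression into r^n / exp r with r tending to
  infinity. This limit for all n is what makes every derivative at 0 exist and vanish.\<close>

lemma exp_bump_tendsto_0: "(exp_bump n \<longlongrightarrow> 0) (at 0)"
proof (rule filterlim_split_at)
  have "eventually (\<lambda>s. exp_bump n s = 0) (at_left 0)"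
    by (auto simp: exp_bump_def eventually_at_filter)
  then show "(exp_bump n \<longlongrightarrow> 0) (at_left 0)"
    by (rule tendsto_eventually)
next
  have "((\<lambda>s. inverse s ^ n / exp (inverse s)) \<longlongrightarrow> (0::real)) (at_right 0)"
    by (rule filterlim_compose[OF tendsto_power_div_exp_0 filterlim_inverse_at_top_right])
  moreover have "eventually (\<lambda>s. exp_bump n s = inverse s ^ n / exp (inverse s)) (at_right 0)"
    by (auto simp: exp_bump_def eventually_at_filter exp_minus divide_inverse)
  ultimately show "(exp_bump n \<longlongrightarrow> 0) (at_right 0)"
    by (simp add: filterlim_cong)
qed

lemma DERIV_exp_bump:
  "(exp_bump n has_real_derivative exp_bump (n + 2) s - n * exp_bump (n + 1) s) (at s)"
proof -
  consider "s < 0" | "s = 0" | "s > 0" by linarith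
  then show ?thesis
  proof cases
    case 1
    have "((\<lambda>s. 0) has_real_derivative 0) (at s)" by simp
    then have "(exp_bump n has_real_derivative 0) (at s)"
      by (rule has_field_derivative_transform_within_open[where S="{..<0}"])
        (use 1 in \<open>auto simp: exp_bump_def\<close>)
    then show ?thesis using 1 by (simp add: exp_bump_def)
  next
    case 2
    \<comment> \<open>For h other than 0, the difference quotient of \<open>exp_bump n\<close> at 0
      is exactly \<open>exp_bump (n + 1) h\<close>.\<close>
    have "((\<lambda>h. (exp_bump n (0 + h) - exp_bump n 0) / h) \<longlongrightarrow> 0) (at 0)"
      by (rule Lim_transform_eventually[OF exp_bump_tendsto_0[of "n + 1"]])
        (auto simp: exp_bump_def eventually_at_filter)
    then show ?thesis using 2 by (simp add: DERIV_def exp_bump_def)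
  next
    case 3
    have "((\<lambda>s. (1 / s) ^ n * exp (- 1 / s)) has_real_derivative
        exp_bump (n + 2) s - n * exp_bump (n + 1) s) (at s)"
    proof -
      have inv: "((\<lambda>s. 1 / s) has_real_derivative - ((1 / s) * (1 / s))) (at s)"
        using DERIV_inverse[of s UNIV] 3 by (simp add: divide_inverse power2_eq_square)
      have "((\<lambda>s. (1 / s) ^ n * exp (- (1 / s))) has_real_derivative
          (1 / s) ^ n * (exp (- (1 / s)) * (- (- ((1 / s) * (1 / s)))))
          + real n * (- ((1 / s) * (1 / s)) * (1 / s) ^ (n - Suc 0)) * exp (- (1 / s))) (at s)"
        by (intro DERIV_mult' DERIV_power DERIV_fun_exp DERIV_minus inv)
      \<comment> \<open>The power rule produces the truncated exponent \<open>n - Suc 0\<close>; the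
        case n = 0 is harmless because that term carries the factor n.\<close>
      moreover have "(1 / s) ^ n * (exp (- (1 / s)) * (- (- ((1 / s) * (1 / s)))))
          + real n * (- ((1 / s) * (1 / s)) * (1 / s) ^ (n - Suc 0)) * exp (- (1 / s))
          = exp_bump (n + 2) s - n * exp_bump (n + 1) s"
        using 3 by (cases n) (simp_all add: exp_bump_def algebra_simps)
      ultimately show ?thesis by simp
    qed
    then show ?thesis
      by (rule has_field_derivative_transform_within_open[where S="{0<..}"])
        (use 3 in \<open>auto simp: exp_bump_def\<close>)
  qed
qed

lemma exp_bump_nonneg: "0 \<le> exp_bump n s"
  by (simp add: exp_bump_def)

lemma exp_bump_0_le_1: "exp_bump 0 s \<le> 1"
  by (simp add: exp_bump_def)

text \<open>A class that contains the bumps of affine functions and all their derivatives. It gives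
  smoothness by induction, without formulas for higher derivatives.\<close>

inductive bump_algebra :: "('a::euclidean_space \<Rightarrow> real) \<Rightarrow> bool" where
  const: "bump_algebra (\<lambda>x. r)"
| bump: "bump_algebra (\<lambda>x. exp_bump n (v \<bullet> x + r))"
| add: "bump_algebra f \<Longrightarrow> bump_algebra g \<Longrightarrow> bump_algebra (\<lambda>x. f x + g x)"
| mult: "bump_algebra f \<Longrightarrow> bump_algebra g \<Longrightarrow> bump_algebra (\<lambda>x. f x * g x)"

lemma bump_algebra_prod:
  assumes "finite I" "\<And>i. i \<in> I \<Longrightarrow> bump_algebra (f i)"
  shows "bump_algebra (\<lambda>x. \<Prod>i\<in>I. f i x)"
  using assms by (induction I) (auto intro: bump_algebra.intros)

lemma bump_algebra_has_derivative:
  "bump_algebra f \<Longrightarrow> \<exists>D. (\<forall>x. (f has_derivative D x) (at x)) \<and> (\<forall>i. bump_algebra (\<lambda>x. D x i))"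
proof (induction rule: bump_algebra.induct)
  case (const r)
  show ?case
    by (rule exI[where x="\<lambda>x h. 0"]) (auto intro: bump_algebra.const)
next
  case (bump n v r)
  let ?g = "\<lambda>x. exp_bump (n + 2) (v \<bullet> x + r) - n * exp_bump (n + 1) (v \<bullet> x + r)"
  have "((\<lambda>x. exp_bump n (v \<bullet> x + r)) has_derivative (\<lambda>h. ?g x * (v \<bullet> h))) (at x)" for x
    by (rule has_derivative_compose[OF _ DERIV_exp_bump[unfolded has_field_derivative_def]])
      (auto intro!: derivative_eq_intros)
  moreover have "bump_algebra (\<lambda>x. ?g x * (v \<bullet> i))" for i
  proof -
    \<comment> \<open>The class has no rule for differences, so the subtraction becomes a
      multiplication by the constant - n.\<close>
    have "bump_algebra (\<lambda>x. (exp_bump (n + 2) (v \<bullet> x + r) + (- real n) * exp_bump (n + 1) (v \<bullet> x + r)) * (v \<bullet> i))"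
      by (intro bump_algebra.intros)
    then show ?thesis by simp
  qed
  ultimately show ?case
    by (intro exI[where x="\<lambda>x h. ?g x * (v \<bullet> h)"]) auto
next
  case (add f g)
  then obtain D E where "\<forall>x. (f has_derivative D x) (at x)" "\<forall>i. bump_algebra (\<lambda>x. D x i)"
    "\<forall>x. (g has_derivative E x) (at x)" "\<forall>i. bump_algebra (\<lambda>x. E x i)" by blast
  then show ?case
    by (intro exI[where x="\<lambda>x h. D x h + E x h"])
      (auto intro!: has_derivative_add bump_algebra.intros)
next
  case (mult f g)
  then obtain D E where "\<forall>x. (f has_derivative D x) (at x)" "\<forall>i. bump_algebra (\<lambda>x. D x i)"
    "\<forall>x. (g has_derivative E x) (at x)" "\<forall>i. bump_algebra (\<lambda>x. E x i)" by blast
  with mult.hyps show ?case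
    by (intro exI[where x="\<lambda>x h. f x * E x h + D x h * g x"])
      (auto intro!: has_derivative_mult bump_algebra.intros)
qed

text \<open>The induction on the order ranges over all members at once, since the partial
  derivatives of f are other members.\<close>

lemma bump_algebra_C_k: "bump_algebra f \<Longrightarrow> C_k k f"
proof (induction k arbitrary: f)
  case 0
  then obtain D where "\<forall>x. (f has_derivative D x) (at x)"
    using bump_algebra_has_derivative by blast
  then show ?case
    by (auto intro: continuous_at_imp_continuous_on has_derivative_continuous)
next
  case (Suc k)
  then obtain D where D: "\<forall>x. (f has_derivative D x) (at x)" "\<forall>i. bump_algebra (\<lambda>x. D x i)"
    using bump_algebra_has_derivative by blast
  then have "frechet_derivative f (at x) = D x" for x
    by (metis frechet_derivative_at)
  with D Suc.IH show ?case
    by (auto simp: differentiable_def)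
qed

text \<open>The shift by \<open>- 1\<close> keeps the support in a compact subset of the open box.\<close>

definition box_bump :: "'a::euclidean_space \<Rightarrow> 'a \<Rightarrow> nat \<Rightarrow> 'a \<Rightarrow> real" where
  "box_bump a b k x =
     (\<Prod>i\<in>Basis. exp_bump 0 (real k * (x \<bullet> i - a \<bullet> i) - 1) * exp_bump 0 (real k * (b \<bullet> i - x \<bullet> i) - 1))"

lemma bump_algebra_box_bump: "bump_algebra (box_bump a b k)"
proof -
  \<comment> \<open>Each factor is put into the affine form v \<bullet> x + r that the generators of
    the class have.\<close>
  have "bump_algebra (\<lambda>x. exp_bump 0 ((real k *\<^sub>R i) \<bullet> x + (- real k * (a \<bullet> i) - 1))
      * exp_bump 0 ((- real k *\<^sub>R i) \<bullet> x + (real k * (b \<bullet> i) - 1)))" for i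
    by (intro bump_algebra.intros)
  moreover have "box_bump a b k = (\<lambda>x. \<Prod>i\<in>Basis. exp_bump 0 ((real k *\<^sub>R i) \<bullet> x + (- real k * (a \<bullet> i) - 1))
      * exp_bump 0 ((- real k *\<^sub>R i) \<bullet> x + (real k * (b \<bullet> i) - 1)))"
    by (auto simp: box_bump_def fun_eq_iff algebra_simps inner_commute intro!: prod.cong)
  ultimately show ?thesis
    by (simp only:) (rule bump_algebra_prod[OF finite_Basis])
qed

lemma box_bump_nonneg: "0 \<le> box_bump a b k x"
  by (auto simp: box_bump_def exp_bump_nonneg intro!: prod_nonneg)

lemma box_bump_le_1: "box_bump a b k x \<le> 1"
  by (auto simp: box_bump_def exp_bump_nonneg exp_bump_0_le_1 intro!: prod_le_1 mult_le_one)

text \<open>All factors must be positive, so x has distance more than 1 / k from every face of the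
  box. For k = 0 all arguments equal - 1 and the bump vanishes.\<close>

lemma box_bump_neq_0D:
  fixes a b :: "'a::euclidean_space"
  assumes "box_bump a b k x \<noteq> 0"
  shows "0 < k" "x \<in> cbox (a + (1 / real k) *\<^sub>R One) (b - (1 / real k) *\<^sub>R One)"
proof -
  have *: "1 < real k * (x \<bullet> i - a \<bullet> i)" "1 < real k * (b \<bullet> i - x \<bullet> i)" if "i \<in> Basis" for i
    using assms that by (auto simp: box_bump_def exp_bump_def split: if_splits)
  obtain i :: 'a where "i \<in> Basis" using nonempty_Basis by blast
  from *[OF this] show k: "0 < k" by (cases k) auto
  show "x \<in> cbox (a + (1 / real k) *\<^sub>R One) (b - (1 / real k) *\<^sub>R One)"
    using * k by (fastforce simp: mem_box inner_simps field_simps)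
qed

lemma test_function_box_bump:
  fixes a b :: "'a::euclidean_space"
  assumes "box a b \<subseteq> \<Omega>"
  shows "test_function \<Omega> (box_bump a b k)"
  unfolding test_function_def
proof (intro conjI allI)
  show "C_k m (box_bump a b k)" for m
    by (rule bump_algebra_C_k[OF bump_algebra_box_bump])
  show "\<exists>K. compact K \<and> K \<subseteq> \<Omega> \<and> (\<forall>x. x \<notin> K \<longrightarrow> box_bump a b k x = 0)"
  proof (cases "k = 0")
    \<comment> \<open>Here \<open>1 / real k\<close> is 0 and the shrunken box would be the full
      closed box, which may leave \<Omega>. The bump is identically zero, so the empty set serves as
      its support.\<close>
    case True
    then show ?thesis
      by (intro exI[where x="{}"]) (use box_bump_neq_0D(1) in fastforce)
  next
    case False
    have "cbox (a + (1 / real k) *\<^sub>R One) (b - (1 / real k) *\<^sub>R One) \<subseteq> box a b"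
    proof
      fix x assume x: "x \<in> cbox (a + (1 / real k) *\<^sub>R One) (b - (1 / real k) *\<^sub>R One)"
      have "1 / real k > 0" using False by simp
      with x show "x \<in> box a b" 
        unfolding mem_box by (auto simp: inner_simps dest!: bspec simp del: zero_less_divide_iff zero_less_divide_1_iff)
    qed
    then show ?thesis
      using assms box_bump_neq_0D(2)[of a b k]
      by (intro exI[where x="cbox (a + (1 / real k) *\<^sub>R One) (b - (1 / real k) *\<^sub>R One)"] conjI
        compact_cbox) (blast+)
  qed
qed

text \<open>For s > 0 the argument tends to infinity and its reciprocal to 0; for s \<le> 0 the
  argument never exceeds - 1.\<close>

lemma exp_bump_rescaled_tendsto:
  "(\<lambda>k. exp_bump 0 (real k * s - 1)) \<longlonglongrightarrow> (if 0 < s then 1 else 0)"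
proof (cases "0 < s")
  case True
  have "filterlim (\<lambda>k. real k * s - 1) at_top sequentially"
    using filterlim_tendsto_add_at_top[OF tendsto_const[of "-1"]
      filterlim_at_top_mult_tendsto_pos[OF tendsto_const True filterlim_real_sequentially]]
    by (simp add: algebra_simps)
  then have "(\<lambda>k. exp (- (1 / (real k * s - 1)))) \<longlonglongrightarrow> exp (- 0)"
    by (intro tendsto_intros tendsto_divide_0[OF tendsto_const] filterlim_at_top_imp_at_infinity)
  moreover have "eventually (\<lambda>k. exp_bump 0 (real k * s - 1) = exp (- (1 / (real k * s - 1)))) sequentially"
    using filterlim_at_top_dense[THEN iffD1, OF \<open>filterlim _ at_top _\<close>, rule_format, of 0]
    by eventually_elim (simp add: exp_bump_def)
  ultimately show ?thesis using True by (simp add: filterlim_cong)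
next
  case False
  then have "exp_bump 0 (real k * s - 1) = 0" for k
    using mult_nonneg_nonpos[of "real k" s] by (auto simp: exp_bump_def)
  then show ?thesis using False by simp
qed

lemma box_bump_tendsto: "(\<lambda>k. box_bump a b k x) \<longlonglongrightarrow> indicator (box a b) x"
proof -
  have "(\<lambda>k. box_bump a b k x) \<longlonglongrightarrow>
      (\<Prod>i\<in>Basis. (if 0 < x \<bullet> i - a \<bullet> i then 1 else 0) * (if 0 < b \<bullet> i - x \<bullet> i then 1 else 0))"
    unfolding box_bump_def by (intro tendsto_intros exp_bump_rescaled_tendsto)
  also have "(\<Prod>i\<in>Basis. (if 0 < x \<bullet> i - a \<bullet> i then 1 else 0) * (if 0 < b \<bullet> i - x \<bullet> i then 1 else 0))
      = (indicator (box a b) x :: real)"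
  proof (cases "x \<in> box a b")
    case False
    then obtain i where "i \<in> Basis" "\<not> (a \<bullet> i < x \<bullet> i \<and> x \<bullet> i < b \<bullet> i)"
      by (auto simp: mem_box)
    then show ?thesis
      using False by (subst prod_zero) auto
  qed (simp add: mem_box)
  finally show ?thesis .
qed


section \<open>The fundamental lemma of the calculus of variations\<close>

text \<open>Open boxes are an intersection-stable generator of the Borel sets, so the integrals over
  all Borel sets vanish by Dynkin's argument. An integrable function with this property is a density
  of the zero measure.\<close>

lemma AE_zero_if_box_integrals_zero:
  fixes g :: "'a::euclidean_space \<Rightarrow> real"
  assumes g: "integrable lebesgue g" "integral\<^sup>L lebesgue g = 0"
    and box: "\<And>a b. (LINT x|lebesgue. indicator (box a b) x * g x) = 0"
  shows "AE x in lebesgue. g x = 0"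
proof -
  \<comment> \<open>The set induction lives on Borel sets, whereas g is only Lebesgue measurable;
    hence the Borel representative.\<close>
  obtain g' where g'[measurable]: "g' \<in> borel_measurable lborel" and "AE x in lborel. g x = g' x"
    using completion_ex_borel_measurable_real[of g lborel] g(1) by auto
  then have eq: "AE x in lebesgue. g x = g' x" by (simp add: AE_completion)
  have [measurable]: "g' \<in> borel_measurable lebesgue" using measurable_completion[OF g'] by simp
  have [measurable]: "g \<in> borel_measurable lebesgue" using g(1) by simp
  have "integrable lebesgue g'"
    using g(1) eq by (subst integrable_cong_AE[where g=g]) auto
  then have int: "integrable lborel g'" by (simp add: integrable_completion)
  have to_g: "(LINT x|lborel. indicator S x * g' x) = (LINT x|lebesgue. indicator S x * g x)"
    if [measurable]: "S \<in> sets borel" for S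
  proof -
    have [measurable]: "S \<in> sets lebesgue" using that by auto
    have "(LINT x|lborel. indicator S x * g' x) = (LINT x|lebesgue. indicator S x * g' x)"
      by (rule integral_completion[symmetric]) measurable
    also have "\<dots> = (LINT x|lebesgue. indicator S x * g x)"
      using eq by (intro integral_cong_AE) auto
    finally show ?thesis .
  qed
  have zero: "(LINT x|lborel. indicator S x * g' x) = 0" if "S \<in> sets borel" for S
  proof -
    let ?G = "range (\<lambda>(a, b). box a b :: 'a set)"
    have S: "S \<in> sigma_sets UNIV ?G"
      using that by (subst (asm) borel_eq_box) simp
    have sets: "A \<in> sets borel" if "A \<in> sigma_sets UNIV ?G" for A
      using that by (subst borel_eq_box) simp
    have "Int_stable ?G"
      by (auto simp: Int_stable_def box_Int_box)
    moreover have "?G \<subseteq> Pow UNIV" by simp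
    ultimately show ?thesis
      using S
    proof (induction rule: sigma_sets_induct_disjoint[where \<Omega>=UNIV])
      case (basic A)
      then show ?case using box by (auto simp: to_g)
    next
      case empty
      then show ?case by simp
    next
      case (compl A)
      have [measurable]: "A \<in> sets borel" by (rule sets) fact
      \<comment> \<open>The integral over a complement is the integral over the whole space minus
        that over A; both vanish, the first by assumption.\<close>
      have "(LINT x|lborel. indicator (UNIV - A) x * g' x)
          = (LINT x|lborel. indicator UNIV x * g' x - indicator A x * g' x)"
        by (rule Bochner_Integration.integral_cong) (auto simp: indicator_def)
      also have "\<dots> = (LINT x|lborel. indicator UNIV x * g' x) - (LINT x|lborel. indicator A x * g' x)"
        using int integrable_mult_indicator[OF _ int, of A] by (intro Bochner_Integration.integral_diff) auto
      also have "\<dots> = 0"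
        using compl(2) g(2) by (subst to_g) simp_all
      finally show ?case .
    next
      case (union A)
      have [measurable]: "A i \<in> sets borel" for i by (rule sets) (use union in auto)
      have "set_lebesgue_integral lborel (\<Union>i. A i) g' = (\<Sum>i. set_lebesgue_integral lborel (A i) g')"
        using int integrable_mult_indicator[OF _ int, of "\<Union>i. A i"] union(1)
        by (intro lebesgue_integral_countable_add)
          (auto simp: disjoint_family_on_def set_integrable_def)
      then show ?case using union(3) by (simp add: set_lebesgue_integral_def)
    qed
  qed
  have "AE x in lborel. g' x = 0"
    using int zero by (intro density_unique_real) (auto simp: set_lebesgue_integral_def)
  with eq show ?thesis
    by (auto simp: AE_completion_iff elim: AE_mp)
qed

text \<open>The bumps of a box inside \<Omega> are test functions with limit its indicator, and |g|
  dominates the products. So g integrates to zero over each such box, and countably many of them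
  cover \<Omega>.\<close>

lemma AE_zero_if_test_integrals_zero:
  fixes g :: "'a::euclidean_space \<Rightarrow> real"
  assumes \<Omega>: "open \<Omega>" and g: "integrable (lebesgue_on \<Omega>) g"
    and test: "\<And>\<phi>. test_function \<Omega> \<phi> \<Longrightarrow> (LINT x|lebesgue_on \<Omega>. g x * \<phi> x) = 0"
  shows "AE x in lebesgue_on \<Omega>. g x = 0"
proof -
  have \<Omega>_sets[measurable]: "\<Omega> \<in> sets lebesgue" using \<Omega> by auto
  have box_zero: "(LINT x|lebesgue_on \<Omega>. g x * indicator (box a b) x) = 0" if "box a b \<subseteq> \<Omega>" for a b
  proof -
    have meas: "box_bump a b k \<in> borel_measurable (lebesgue_on \<Omega>)" for k
    proof -
      have "continuous_on UNIV (box_bump a b k)"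
        using bump_algebra_C_k[OF bump_algebra_box_bump, of 0 a b k] by simp
      then show ?thesis
        by (intro continuous_imp_measurable_on_sets_lebesgue \<Omega>_sets) (auto intro: continuous_on_subset)
    qed
    have "box a b \<inter> \<Omega> \<in> sets (lebesgue_on \<Omega>)" by (auto simp: sets_restrict_space)
    then have ind: "indicator (box a b) \<in> borel_measurable (lebesgue_on \<Omega>)"
      by (intro borel_measurable_indicator') (auto simp: space_restrict_space Int_def conj_commute)
    have gm: "g \<in> borel_measurable (lebesgue_on \<Omega>)" using g by simp
    have "(\<lambda>k. LINT x|lebesgue_on \<Omega>. g x * box_bump a b k x)
        \<longlonglongrightarrow> (LINT x|lebesgue_on \<Omega>. g x * indicator (box a b) x)"
    proof (rule integral_dominated_convergence[where w="\<lambda>x. norm (g x)"])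
      show "AE x in lebesgue_on \<Omega>. (\<lambda>k. g x * box_bump a b k x) \<longlonglongrightarrow> g x * indicator (box a b) x"
        by (intro AE_I2 tendsto_intros box_bump_tendsto)
      show "AE x in lebesgue_on \<Omega>. norm (g x * box_bump a b k x) \<le> norm (g x)" for k
        by (intro AE_I2) (simp add: abs_mult box_bump_nonneg box_bump_le_1 mult_left_le)
    qed (use g gm meas ind in \<open>auto intro!: borel_measurable_times\<close>)
    moreover have "(LINT x|lebesgue_on \<Omega>. g x * box_bump a b k x) = 0" for k
      by (rule test[OF test_function_box_bump[OF that]])
    ultimately show ?thesis
      by (simp add: LIMSEQ_const_iff)
  qed
  have AE_box: "AE x in lebesgue. x \<in> box a b \<longrightarrow> g x = 0" if ab: "box a b \<subseteq> \<Omega>" for a b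
  proof -
    \<comment> \<open>Cutting g off outside the box gives a function on the whole space. Its
      integral over any other box is that of g over an intersection of boxes, which is again a box
      inside \<Omega>.\<close>
    let ?h = "\<lambda>x. indicator (box a b) x * g x"
    have restrict: "(LINT x|lebesgue. indicator (box c d) x * ?h x) = 0" for c d
    proof -
      obtain p q where pq: "box a b \<inter> box c d = box p q" using box_Int_box by blast
      have "(LINT x|lebesgue. indicator (box c d) x * ?h x)
          = (LINT x|lebesgue. indicator \<Omega> x *\<^sub>R (g x * indicator (box p q) x))"
        using ab pq[symmetric] by (intro Bochner_Integration.integral_cong) (auto simp: indicator_def)
      also have "\<dots> = (LINT x|lebesgue_on \<Omega>. g x * indicator (box p q) x)"
        by (subst integral_restrict_space) auto
      also have "\<dots> = 0" using ab pq by (intro box_zero) auto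
      finally show ?thesis .
    qed
    have "integrable lebesgue (\<lambda>x. indicator \<Omega> x *\<^sub>R g x)"
      using g integrable_restrict_space[of \<Omega> lebesgue g] by simp
    then have "integrable lebesgue (\<lambda>x. indicator (box a b) x *\<^sub>R (indicator \<Omega> x *\<^sub>R g x))"
      by (rule integrable_mult_indicator[rotated]) auto
    moreover have "(\<lambda>x. indicator (box a b) x *\<^sub>R (indicator \<Omega> x *\<^sub>R g x)) = ?h"
      using ab by (auto simp: indicator_def fun_eq_iff)
    ultimately have "integrable lebesgue ?h" by simp
    moreover have "integral\<^sup>L lebesgue ?h = 0"
    proof -
      have "integral\<^sup>L lebesgue ?h = (LINT x|lebesgue. indicator (box a b) x * ?h x)"
        by (intro Bochner_Integration.integral_cong) (auto simp: indicator_def)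
      then show ?thesis using restrict by simp
    qed
    ultimately have "AE x in lebesgue. ?h x = 0"
      using restrict by (rule AE_zero_if_box_integrals_zero)
    then show ?thesis by eventually_elim (auto simp: indicator_def split: if_splits)
  qed
  obtain D where D: "countable D" "D \<subseteq> Pow \<Omega>" "\<And>X. X \<in> D \<Longrightarrow> \<exists>a b. X = box a b" "\<Union>D = \<Omega>"
    using open_countable_Union_open_box[OF \<Omega>] by blast
  have "AE x in lebesgue. \<forall>X\<in>D. x \<in> X \<longrightarrow> g x = 0"
  proof (subst AE_ball_countable[OF D(1)], rule ballI)
    fix X assume X: "X \<in> D"
    with D(3) obtain a b where "X = box a b" by blast
    with X D(2) show "AE x in lebesgue. x \<in> X \<longrightarrow> g x = 0"
      using AE_box by blast
  qed
  then have "AE x in lebesgue. x \<in> \<Omega> \<longrightarrow> g x = 0"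
    by eventually_elim (use D(4) in blast)
  then show ?thesis
    using AE_restrict_space_iff[of \<Omega> lebesgue] by simp
qed


section \<open>Square integrable functions and weak gradients\<close>

lemma integrable_L2_inner:
  assumes "f \<in> L2 \<Omega>" "g \<in> L2 \<Omega>"
  shows "integrable (lebesgue_on \<Omega>) (\<lambda>x. f x \<bullet> g x)"
proof (rule Bochner_Integration.integrable_bound[where f="\<lambda>x. (norm (f x))\<^sup>2 + (norm (g x))\<^sup>2"])
  have "\<bar>a \<bullet> b\<bar> \<le> (norm a)\<^sup>2 + (norm b)\<^sup>2" for a b :: 'b
    using Cauchy_Schwarz_ineq2[of a b] sum_squares_bound[of "norm a" "norm b"]
      mult_nonneg_nonneg[OF norm_ge_zero norm_ge_zero, of a b] by linarith
  then show "AE x in lebesgue_on \<Omega>. norm (f x \<bullet> g x) \<le> norm ((norm (f x))\<^sup>2 + (norm (g x))\<^sup>2)"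
    by simp
qed (use assms in \<open>auto simp: L2_def\<close>)

lemma integrable_L2_mult:
  fixes f g :: "_ \<Rightarrow> real"
  assumes "f \<in> L2 \<Omega>" "g \<in> L2 \<Omega>"
  shows "integrable (lebesgue_on \<Omega>) (\<lambda>x. f x * g x)"
  using integrable_L2_inner[OF assms] by simp

lemma L2_dominated:
  assumes f: "f \<in> L2 \<Omega>" and g: "g \<in> borel_measurable (lebesgue_on \<Omega>)"
    and le: "\<And>x. norm (g x) \<le> C * norm (f x)"
  shows "g \<in> L2 \<Omega>"
proof -
  have "(norm (g x))\<^sup>2 \<le> C\<^sup>2 * (norm (f x))\<^sup>2" for x
    using power_mono[OF le, of x 2] by (simp add: power_mult_distrib)
  then have "integrable (lebesgue_on \<Omega>) (\<lambda>x. (norm (g x))\<^sup>2)"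
    using f g
    by (intro Bochner_Integration.integrable_bound[where f="\<lambda>x. C\<^sup>2 * (norm (f x))\<^sup>2" and g="\<lambda>x. (norm (g x))\<^sup>2"])
      (auto simp: L2_def)
  then show ?thesis using g by (simp add: L2_def)
qed

lemma L2_diff:
  assumes f: "f \<in> L2 \<Omega>" and g: "g \<in> L2 \<Omega>"
  shows "(\<lambda>x. f x - g x) \<in> L2 \<Omega>"
proof -
  have "integrable (lebesgue_on \<Omega>) (\<lambda>x. (norm (f x))\<^sup>2 - 2 * (f x \<bullet> g x) + (norm (g x))\<^sup>2)"
    using f g by (intro Bochner_Integration.integrable_add Bochner_Integration.integrable_diff
        Bochner_Integration.integrable_mult_right integrable_L2_inner) (auto simp: L2_def)
  moreover have "(norm (f x - g x))\<^sup>2 = (norm (f x))\<^sup>2 - 2 * (f x \<bullet> g x) + (norm (g x))\<^sup>2" for x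
    by (simp add: power2_norm_eq_inner inner_simps inner_commute)
  ultimately show ?thesis using f g by (auto simp: L2_def)
qed

lemma L2_scaleR:
  assumes "f \<in> L2 \<Omega>"
  shows "(\<lambda>x. c *\<^sub>R f x) \<in> L2 \<Omega>"
  using assms by (auto simp: L2_def power_mult_distrib)

lemma L2_inner_self: "L2_inner \<Omega> f f = (L2_norm \<Omega> f)\<^sup>2"
  by (simp add: L2_inner_def L2_norm_def power2_norm_eq_inner)

lemma L2_norm_nonneg: "0 \<le> L2_norm \<Omega> f"
  by (simp add: L2_norm_def)

lemma L2_norm_cong_AE:
  assumes "f \<in> borel_measurable (lebesgue_on \<Omega>)" "g \<in> borel_measurable (lebesgue_on \<Omega>)"
    "AE x in lebesgue_on \<Omega>. f x = g x"
  shows "L2_norm \<Omega> f = L2_norm \<Omega> g"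
  unfolding L2_norm_def using assms by (intro arg_cong[where f=sqrt] integral_cong_AE) auto

lemma L2_inner_cong_AE:
  assumes "f \<in> L2 \<Omega>" "f' \<in> L2 \<Omega>" "g \<in> L2 \<Omega>" "g' \<in> L2 \<Omega>"
    "AE x in lebesgue_on \<Omega>. f x = f' x" "AE x in lebesgue_on \<Omega>. g x = g' x"
  shows "L2_inner \<Omega> f g = L2_inner \<Omega> f' g'"
  unfolding L2_inner_def using assms by (intro integral_cong_AE) (auto simp: L2_def)

lemma L2_norm_scaleR: "L2_norm \<Omega> (\<lambda>x. c *\<^sub>R f x) = \<bar>c\<bar> * L2_norm \<Omega> f"
  by (simp add: L2_norm_def power_mult_distrib real_sqrt_mult)

lemma L2_inner_diff_left:
  assumes "f \<in> L2 \<Omega>" "g \<in> L2 \<Omega>" "h \<in> L2 \<Omega>"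
  shows "L2_inner \<Omega> (\<lambda>x. f x - g x) h = L2_inner \<Omega> f h - L2_inner \<Omega> g h"
  unfolding L2_inner_def inner_diff_left
  using assms by (intro Bochner_Integration.integral_diff integrable_L2_inner)

lemma L2_inner_scaleR_right: "L2_inner \<Omega> f (\<lambda>x. c *\<^sub>R g x) = c * L2_inner \<Omega> f g"
  by (simp add: L2_inner_def)

text \<open>The pointwise inequality 2 |a \<bullet> b| \<le> |a|^2 + |b|^2 is integrated. With
  squares on the right the result can be absorbed directly in the energy estimate.\<close>

lemma L2_inner_le:
  assumes "f \<in> L2 \<Omega>" "g \<in> L2 \<Omega>"
  shows "2 * \<bar>L2_inner \<Omega> f g\<bar> \<le> (L2_norm \<Omega> f)\<^sup>2 + (L2_norm \<Omega> g)\<^sup>2"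
proof -
  have ab: "2 * \<bar>a \<bullet> b\<bar> \<le> (norm a)\<^sup>2 + (norm b)\<^sup>2" for a b :: 'b
    using Cauchy_Schwarz_ineq2[of a b] sum_squares_bound[of "norm a" "norm b"] by simp
  have "2 * \<bar>L2_inner \<Omega> f g\<bar> \<le> 2 * (LINT x|lebesgue_on \<Omega>. \<bar>f x \<bullet> g x\<bar>)"
    unfolding L2_inner_def by (intro mult_left_mono integral_abs_bound) simp
  also have "\<dots> = (LINT x|lebesgue_on \<Omega>. 2 * \<bar>f x \<bullet> g x\<bar>)" by simp
  also have "\<dots> \<le> (LINT x|lebesgue_on \<Omega>. (norm (f x))\<^sup>2 + (norm (g x))\<^sup>2)"
    using assms integrable_L2_inner[OF assms] ab by (intro integral_mono) (auto simp: L2_def)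
  also have "\<dots> = (L2_norm \<Omega> f)\<^sup>2 + (L2_norm \<Omega> g)\<^sup>2"
    using assms by (simp add: L2_def L2_norm_def)
  finally show ?thesis .
qed

lemma L2_norm_eq_0_imp_AE:
  assumes "f \<in> L2 \<Omega>" "L2_norm \<Omega> f = 0"
  shows "AE x in lebesgue_on \<Omega>. f x = 0"
proof -
  have "(LINT x|lebesgue_on \<Omega>. (norm (f x))\<^sup>2) = 0" using assms(2) by (simp add: L2_norm_def)
  then have "AE x in lebesgue_on \<Omega>. (norm (f x))\<^sup>2 = 0"
    using assms(1) by (subst (asm) integral_nonneg_eq_0_iff_AE) (auto simp: L2_def)
  then show ?thesis by simp
qed

section \<open>Weak gradients and the dual norm on a bounded open set\<close>

locale bounded_open_set =
  fixes \<Omega> :: "'a::euclidean_space set"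
  assumes open_\<Omega>: "open \<Omega>" and bounded_\<Omega>: "bounded \<Omega>"
begin

lemma sets_\<Omega>: "\<Omega> \<in> sets lebesgue"
  using open_\<Omega> by auto

text \<open>The function is bounded on the compact closure of \<Omega>, and \<Omega> has finite
  measure.\<close>

lemma continuous_L2:
  assumes "continuous_on UNIV \<phi>"
  shows "\<phi> \<in> L2 \<Omega>"
proof -
  have "\<phi> \<in> borel_measurable (lebesgue_on \<Omega>)"
    by (intro continuous_imp_measurable_on_sets_lebesgue sets_\<Omega>)
      (rule continuous_on_subset[OF assms], simp)
  moreover have "integrable (lebesgue_on \<Omega>) (\<lambda>x. (norm (\<phi> x))\<^sup>2)"
  proof -
    have "compact (\<phi> ` closure \<Omega>)"
      using bounded_\<Omega> assms by (intro compact_continuous_image) (auto intro: continuous_on_subset)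
    then obtain B where B: "\<forall>x\<in>closure \<Omega>. norm (\<phi> x) \<le> B"
      by (auto dest!: compact_imp_bounded simp: bounded_iff)
    interpret finite_measure "lebesgue_on \<Omega>"
      using bounded_\<Omega> sets_\<Omega> by (intro finite_measure_lebesgue_on bounded_set_imp_lmeasurable)
    show ?thesis
      using calculation B closure_subset[of \<Omega>]
      by (intro integrable_const_bound[where B="B\<^sup>2"] AE_I2)
        (auto simp: space_restrict_space intro!: power_mono)
  qed
  ultimately show ?thesis by (simp add: L2_def)
qed

lemma test_function_L2:
  assumes "test_function \<Omega> \<phi>"
  shows "\<phi> \<in> L2 \<Omega>"
  using assms continuous_L2 C_k.simps(1) unfolding test_function_def by blast

lemma test_function_deriv_L2:
  assumes "test_function \<Omega> \<phi>" "i \<in> Basis"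
  shows "(\<lambda>x. frechet_derivative \<phi> (at x) i) \<in> L2 \<Omega>"
proof -
  have "C_k (Suc 0) \<phi>" using assms by (simp add: test_function_def del: C_k.simps)
  then show ?thesis using assms(2) by (intro continuous_L2) simp
qed

lemma L2_inner_Basis:
  assumes "g \<in> L2 \<Omega>" "i \<in> Basis"
  shows "(\<lambda>x. g x \<bullet> i) \<in> L2 \<Omega>"
proof (rule L2_dominated[OF assms(1)])
  show "(\<lambda>x. g x \<bullet> i) \<in> borel_measurable (lebesgue_on \<Omega>)"
    using assms(1) by (intro borel_measurable_inner borel_measurable_const) (simp add: L2_def)
  show "norm (g x \<bullet> i) \<le> 1 * norm (g x)" for x
    using Basis_le_norm[OF assms(2)] by simp
qed

text \<open>Tested with any \<phi>, the components of g and h give the same number, fixed by f. The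
  fundamental lemma applies to each component of the difference, and there are finitely
  many.\<close>

lemma weak_gradient_unique:
  assumes g: "g \<in> L2 \<Omega>" "has_weak_gradient \<Omega> f g" and h: "h \<in> L2 \<Omega>" "has_weak_gradient \<Omega> f h"
  shows "AE x in lebesgue_on \<Omega>. g x = h x"
proof -
  have "AE x in lebesgue_on \<Omega>. g x \<bullet> i - h x \<bullet> i = 0" if i: "i \<in> Basis" for i
  proof (rule AE_zero_if_test_integrals_zero[OF open_\<Omega>])
    note L2 = L2_inner_Basis[OF g(1) i] L2_inner_Basis[OF h(1) i]
    \<comment> \<open>On a bounded set the constant 1 is square integrable, so pairing with it shows
      that L2 functions are integrable.\<close>
    show "integrable (lebesgue_on \<Omega>) (\<lambda>x. g x \<bullet> i - h x \<bullet> i)"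
      using integrable_L2_mult[OF L2_diff[OF L2] continuous_L2[OF continuous_on_const[of _ 1]]] by simp
    fix \<phi> :: "'a \<Rightarrow> real" assume \<phi>: "test_function \<Omega> \<phi>"
    have "(LINT x|lebesgue_on \<Omega>. (g x \<bullet> i - h x \<bullet> i) * \<phi> x)
        = (LINT x|lebesgue_on \<Omega>. (g x \<bullet> i) * \<phi> x) - (LINT x|lebesgue_on \<Omega>. (h x \<bullet> i) * \<phi> x)"
      unfolding left_diff_distrib
      by (intro Bochner_Integration.integral_diff integrable_L2_mult L2 test_function_L2[OF \<phi>])
    also have "\<dots> = 0"
      using g(2) h(2) \<phi> i by (simp add: has_weak_gradient_def)
    finally show "(LINT x|lebesgue_on \<Omega>. (g x \<bullet> i - h x \<bullet> i) * \<phi> x) = 0" .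
  qed
  then have "AE x in lebesgue_on \<Omega>. \<forall>i\<in>Basis. g x \<bullet> i - h x \<bullet> i = 0"
    by (intro AE_finite_allI) auto
  then show ?thesis by (auto elim!: eventually_mono intro: euclidean_eqI)
qed

lemma has_weak_gradient_diff:
  assumes "f \<in> L2 \<Omega>" "g \<in> L2 \<Omega>" "f' \<in> L2 \<Omega>" "g' \<in> L2 \<Omega>"
    and "has_weak_gradient \<Omega> f f'" "has_weak_gradient \<Omega> g g'"
  shows "has_weak_gradient \<Omega> (\<lambda>x. f x - g x) (\<lambda>x. f' x - g' x)"
  unfolding has_weak_gradient_def
proof (intro allI impI ballI)
  fix \<phi> and i :: 'a assume \<phi>: "test_function \<Omega> \<phi>" and i: "i \<in> Basis"
  have "(LINT x|lebesgue_on \<Omega>. (f x - g x) * frechet_derivative \<phi> (at x) i)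
      = (LINT x|lebesgue_on \<Omega>. f x * frechet_derivative \<phi> (at x) i)
        - (LINT x|lebesgue_on \<Omega>. g x * frechet_derivative \<phi> (at x) i)"
    unfolding left_diff_distrib
    by (intro Bochner_Integration.integral_diff integrable_L2_mult assms test_function_deriv_L2[OF \<phi> i])
  also have "\<dots> = - ((LINT x|lebesgue_on \<Omega>. (f' x \<bullet> i) * \<phi> x) - (LINT x|lebesgue_on \<Omega>. (g' x \<bullet> i) * \<phi> x))"
    using assms \<phi> i by (simp add: has_weak_gradient_def)
  also have "\<dots> = - (LINT x|lebesgue_on \<Omega>. ((f' x - g' x) \<bullet> i) * \<phi> x)"
    unfolding left_diff_distrib inner_diff_left
    by (subst Bochner_Integration.integral_diff)
      (intro integrable_L2_mult L2_inner_Basis assms i test_function_L2[OF \<phi>] refl)+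
  finally show "(LINT x|lebesgue_on \<Omega>. (f x - g x) * frechet_derivative \<phi> (at x) i)
      = - (LINT x|lebesgue_on \<Omega>. ((f' x - g' x) \<bullet> i) * \<phi> x)" .
qed

lemma has_weak_gradient_scaleR:
  assumes "has_weak_gradient \<Omega> f f'"
  shows "has_weak_gradient \<Omega> (\<lambda>x. c *\<^sub>R f x) (\<lambda>x. c *\<^sub>R f' x)"
  using assms by (simp add: has_weak_gradient_def mult.assoc)

lemma H1_L2: "f \<in> H1 \<Omega> \<Longrightarrow> f \<in> L2 \<Omega>"
  by (simp add: H1_def)

lemma weak_grad:
  assumes "f \<in> H1 \<Omega>"
  shows "weak_grad \<Omega> f \<in> L2 \<Omega>" "has_weak_gradient \<Omega> f (weak_grad \<Omega> f)"
proof -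
  have "\<exists>g. g \<in> L2 \<Omega> \<and> has_weak_gradient \<Omega> f g" using assms by (auto simp: H1_def)
  from someI_ex[OF this] show "weak_grad \<Omega> f \<in> L2 \<Omega>" "has_weak_gradient \<Omega> f (weak_grad \<Omega> f)"
    by (simp_all add: weak_grad_def)
qed

text \<open>\<open>weak_grad\<close> is a choice among representatives, so it is additive only up to
  null sets, by uniqueness.\<close>

lemma H1_diff:
  assumes f: "f \<in> H1 \<Omega>" and g: "g \<in> H1 \<Omega>"
  shows "(\<lambda>x. f x - g x) \<in> H1 \<Omega>"
    and "AE x in lebesgue_on \<Omega>. weak_grad \<Omega> (\<lambda>x. f x - g x) x = weak_grad \<Omega> f x - weak_grad \<Omega> g x"
proof -
  note grad = L2_diff[OF weak_grad(1)[OF f] weak_grad(1)[OF g]]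
    has_weak_gradient_diff[OF H1_L2[OF f] H1_L2[OF g] weak_grad(1)[OF f] weak_grad(1)[OF g]
      weak_grad(2)[OF f] weak_grad(2)[OF g]]
  show H1: "(\<lambda>x. f x - g x) \<in> H1 \<Omega>"
    using grad L2_diff[OF H1_L2[OF f] H1_L2[OF g]] by (auto simp: H1_def)
  show "AE x in lebesgue_on \<Omega>. weak_grad \<Omega> (\<lambda>x. f x - g x) x = weak_grad \<Omega> f x - weak_grad \<Omega> g x"
    by (rule weak_gradient_unique[OF weak_grad[OF H1] grad])
qed

lemma H1_scaleR:
  assumes f: "f \<in> H1 \<Omega>"
  shows "(\<lambda>x. c *\<^sub>R f x) \<in> H1 \<Omega>" and "H1_norm \<Omega> (\<lambda>x. c *\<^sub>R f x) = \<bar>c\<bar> * H1_norm \<Omega> f"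
proof -
  note grad = L2_scaleR[OF weak_grad(1)[OF f], of c] has_weak_gradient_scaleR[OF weak_grad(2)[OF f], of c]
  show H1: "(\<lambda>x. c *\<^sub>R f x) \<in> H1 \<Omega>"
    using grad L2_scaleR[OF H1_L2[OF f], of c] unfolding H1_def by blast
  have "AE x in lebesgue_on \<Omega>. weak_grad \<Omega> (\<lambda>x. c *\<^sub>R f x) x = c *\<^sub>R weak_grad \<Omega> f x"
    by (rule weak_gradient_unique[OF weak_grad[OF H1] grad])
  then have "L2_norm \<Omega> (weak_grad \<Omega> (\<lambda>x. c *\<^sub>R f x)) = L2_norm \<Omega> (\<lambda>x. c *\<^sub>R weak_grad \<Omega> f x)"
    using weak_grad(1)[OF H1] grad(1) by (intro L2_norm_cong_AE) (auto simp: L2_def)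
  then have "H1_norm \<Omega> (\<lambda>x. c *\<^sub>R f x)
      = sqrt (c\<^sup>2 * ((L2_norm \<Omega> f)\<^sup>2 + (L2_norm \<Omega> (weak_grad \<Omega> f))\<^sup>2))"
    unfolding H1_norm_def by (simp only: L2_norm_scaleR power_mult_distrib power2_abs distrib_left)
  then show "H1_norm \<Omega> (\<lambda>x. c *\<^sub>R f x) = \<bar>c\<bar> * H1_norm \<Omega> f"
    by (simp add: real_sqrt_mult H1_norm_def)
qed

text \<open>Both functions have the same set of weak gradients, so the choice operator picks the
  same element. The equality is therefore exact and not merely almost everywhere.\<close>

lemma weak_grad_cong_AE:
  assumes "f \<in> L2 \<Omega>" "g \<in> L2 \<Omega>" "AE x in lebesgue_on \<Omega>. f x = g x"
  shows "weak_grad \<Omega> f = weak_grad \<Omega> g"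
proof -
  have "(LINT x|lebesgue_on \<Omega>. f x * frechet_derivative \<phi> (at x) i)
      = (LINT x|lebesgue_on \<Omega>. g x * frechet_derivative \<phi> (at x) i)"
    if "test_function \<Omega> \<phi>" "i \<in> Basis" for \<phi> i
    using assms test_function_deriv_L2[OF that] by (intro integral_cong_AE) (auto simp: L2_def)
  then have "has_weak_gradient \<Omega> f h \<longleftrightarrow> has_weak_gradient \<Omega> g h" for h
    by (simp add: has_weak_gradient_def cong: imp_cong)
  then show ?thesis by (simp add: weak_grad_def)
qed

lemma H1_norm_nonneg: "0 \<le> H1_norm \<Omega> f"
  by (simp add: H1_norm_def)

lemma L2_norm_le_H1_norm: "L2_norm \<Omega> f \<le> H1_norm \<Omega> f"
  by (simp add: H1_norm_def real_le_rsqrt)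

text \<open>Scaling e to unit norm makes it a competitor in the supremum. If the norm is 0, then e
  vanishes almost everywhere, and so does the pairing.\<close>

lemma L2_inner_le_H1_dual_norm:
  assumes w: "w \<in> L2 \<Omega>" and e: "e \<in> H1 \<Omega>"
  shows "\<bar>L2_inner \<Omega> w e\<bar> \<le> H1_dual_norm \<Omega> (L2_inner \<Omega> w) * H1_norm \<Omega> e"
proof (cases "H1_norm \<Omega> e = 0")
  case True
  then have "L2_norm \<Omega> e = 0"
    using L2_norm_le_H1_norm[of e] L2_norm_nonneg[of \<Omega> e] by simp
  then have "AE x in lebesgue_on \<Omega>. w x \<bullet> e x = 0"
    using L2_norm_eq_0_imp_AE[OF H1_L2[OF e]] by auto
  then have "L2_inner \<Omega> w e = 0"
    unfolding L2_inner_def by (rule integral_eq_zero_AE)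
  then show ?thesis using True by simp
next
  case False
  then have pos: "0 < H1_norm \<Omega> e" using H1_norm_nonneg[of e] by simp
  let ?c = "1 / H1_norm \<Omega> e"
  \<comment> \<open>A real supremum bounds its members only if the set is bounded above; here w
    \<in> L2 provides the bound.\<close>
  have "bdd_above ((\<lambda>\<phi>. \<bar>L2_inner \<Omega> w \<phi>\<bar>) ` {\<phi> \<in> H1 \<Omega>. H1_norm \<Omega> \<phi> \<le> 1})"
  proof (rule bdd_aboveI2)
    fix \<phi> assume \<phi>: "\<phi> \<in> {\<phi> \<in> H1 \<Omega>. H1_norm \<Omega> \<phi> \<le> 1}"
    then have "(L2_norm \<Omega> \<phi>)\<^sup>2 \<le> 1"
      using L2_norm_le_H1_norm[of \<phi>] L2_norm_nonneg[of \<Omega> \<phi>] by (simp add: abs_square_le_1)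
    then show "\<bar>L2_inner \<Omega> w \<phi>\<bar> \<le> (L2_norm \<Omega> w)\<^sup>2 + 1"
      using L2_inner_le[OF w H1_L2, of \<phi>] \<phi> zero_le_power2[of "L2_norm \<Omega> w"] by simp
  qed
  moreover have "(\<lambda>x. ?c *\<^sub>R e x) \<in> {\<phi> \<in> H1 \<Omega>. H1_norm \<Omega> \<phi> \<le> 1}"
    using H1_scaleR[OF e, of ?c] pos by simp
  ultimately have "\<bar>L2_inner \<Omega> w (\<lambda>x. ?c *\<^sub>R e x)\<bar> \<le> H1_dual_norm \<Omega> (L2_inner \<Omega> w)"
    unfolding H1_dual_norm_def by (rule cSUP_upper2[OF _ _ order_refl])
  then show ?thesis
    using pos by (simp only: L2_inner_scaleR_right) (simp add: abs_mult field_simps)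
qed

end


section \<open>The discrete Gronwall estimate and step functions in time\<close>

text \<open>Each f n + C id is nondecreasing, and the resulting inequality passes to the pointwise
  limit, so g itself is never differentiated. In the application f n is the first derivative of the
  regularization, and g is \<psi>'.\<close>

lemma one_sided_lipschitz_limit:
  fixes f f' :: "nat \<Rightarrow> real \<Rightarrow> real"
  assumes deriv: "\<And>n s. (f n has_real_derivative f' n s) (at s)" and lower: "\<And>n s. - C \<le> f' n s"
    and lim: "\<And>s. (\<lambda>n. f n s) \<longlonglongrightarrow> g s"
  shows "- C * (a - b)\<^sup>2 \<le> (g a - g b) * (a - b)"
proof -
  have mono: "f n p + C * p \<le> f n q + C * q" if "p \<le> q" for n p q
  proof (rule DERIV_nonneg_imp_nondecreasing[OF that])
    show "\<exists>y. ((\<lambda>s. f n s + C * s) has_real_derivative y) (at s) \<and> 0 \<le> y" for s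
      using lower[of n s] by (intro exI[of _ "f' n s + C"]) (auto intro!: derivative_eq_intros deriv)
  qed
  have "- C * (a - b)\<^sup>2 \<le> (f n a - f n b) * (a - b)" for n
  proof -
    have "0 \<le> ((f n a + C * a) - (f n b + C * b)) * (a - b)"
      using mono[of a b n] mono[of b a n] by (cases "a \<le> b") (auto intro: mult_nonneg_nonneg mult_nonpos_nonpos)
    then show ?thesis by (simp add: algebra_simps power2_eq_square)
  qed
  moreover have "(\<lambda>n. (f n a - f n b) * (a - b)) \<longlonglongrightarrow> (g a - g b) * (a - b)"
    by (intro tendsto_intros lim)
  ultimately show ?thesis by (intro LIMSEQ_le_const) auto
qed

text \<open>With x = l \<tau> j, a step costs the factor 1 / (1 - x) \<le> exp (x / (1 - q)). The
  margin q < 1 makes the rate l / (1 - q) common to all steps, so the factors multiply to an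
  exponential of the elapsed time.\<close>

lemma discrete_gronwall:
  fixes a b d \<tau> :: "nat \<Rightarrow> real"
  assumes step: "\<And>j. j \<in> {1..N} \<Longrightarrow> (1 - l * \<tau> j) * a j + d j \<le> a (j - 1) + b j"
    and l: "0 \<le> l" and \<tau>: "\<And>j. j \<in> {1..N} \<Longrightarrow> 0 \<le> \<tau> j" "\<And>j. j \<in> {1..N} \<Longrightarrow> l * \<tau> j \<le> q" and q: "q < 1"
    and nonneg: "\<And>j. 0 \<le> a j" "\<And>j. j \<in> {1..N} \<Longrightarrow> 0 \<le> b j" "\<And>j. j \<in> {1..N} \<Longrightarrow> 0 \<le> d j"
    and n: "n \<le> N"
  shows "a n + (\<Sum>j=1..n. d j) \<le> exp (l / (1 - q) * (\<Sum>j=1..n. \<tau> j)) * (a 0 + (\<Sum>j=1..n. b j))"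
  using n
proof (induction n)
  case 0
  then show ?case by simp
next
  case (Suc n)
  let ?j = "Suc n" and ?m = "l / (1 - q)"
  let ?D = "\<Sum>j=1..n. d j" and ?B = "\<Sum>j=1..n. b j" and ?S = "\<Sum>j=1..n. \<tau> j"
  have j: "?j \<in> {1..N}" using Suc.prems by simp
  have D: "0 \<le> ?D" using Suc.prems nonneg(3) by (intro sum_nonneg) auto
  define x where "x = l * \<tau> ?j"
  have x: "0 \<le> x" "x \<le> q" "x < 1" using \<tau>[OF j] l q by (auto simp: x_def)
  have "1 / (1 - x) = 1 + x / (1 - x)" using x by (simp add: field_simps)
  also have "\<dots> \<le> exp (x / (1 - x))" by (rule exp_ge_add_one_self)
  also have "\<dots> \<le> exp (x / (1 - q))" using x q by (auto intro!: divide_left_mono)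
  also have "x / (1 - q) = ?m * \<tau> ?j" by (simp add: x_def)
  finally have growth: "1 \<le> exp (?m * \<tau> ?j) * (1 - x)" using x by (simp add: divide_simps)
  have exp1: "1 \<le> exp (?m * \<tau> ?j)" using l q \<tau>(1)[OF j] by simp
  have expS: "1 \<le> exp (?m * ?S)"
    using l q Suc.prems \<tau>(1) by (auto intro!: mult_nonneg_nonneg divide_nonneg_nonneg sum_nonneg)
  \<comment> \<open>The two parts are enlarged differently: \<open>growth\<close> supplies the
    factor 1 - x on the new value, \<open>exp1\<close> only a factor at least 1 on the sum of the
    d.\<close>
  have "a ?j + (?D + d ?j) \<le> exp (?m * \<tau> ?j) * (1 - x) * a ?j + exp (?m * \<tau> ?j) * (?D + d ?j)"
    using mult_right_mono[OF growth nonneg(1)[of ?j]] mult_right_mono[OF exp1, of "?D + d ?j"] D nonneg(3)[OF j]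
    by simp
  also have "\<dots> = exp (?m * \<tau> ?j) * ((1 - x) * a ?j + d ?j + ?D)" by (simp add: algebra_simps)
  also have "\<dots> \<le> exp (?m * \<tau> ?j) * (a n + ?D + b ?j)"
    using step[OF j] by (intro mult_left_mono) (simp_all add: x_def)
  \<comment> \<open>The new term b also receives the factor exp (?m * ?S) \<ge> 1, so that the
    exponential can be taken out of the whole sum.\<close>
  also have "\<dots> \<le> exp (?m * \<tau> ?j) * (exp (?m * ?S) * (a 0 + ?B) + exp (?m * ?S) * b ?j)"
    using Suc.IH Suc.prems mult_right_mono[OF expS nonneg(2)[OF j]] by (intro mult_left_mono add_mono) auto
  also have "\<dots> = exp (?m * (?S + \<tau> ?j)) * (a 0 + (?B + b ?j))"
    by (simp add: exp_add algebra_simps)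
  finally show ?case by simp
qed

section \<open>Step functions on a time grid\<close>

lemma time_grid_less:
  assumes "time_grid T N t" "i < j" "j \<le> N"
  shows "t i < t j"
  using assms(2,3)
proof (induction j)
  case (Suc j)
  have "t j < t (Suc j)"
    using assms(1) Suc.prems by (auto simp: time_grid_def dest!: bspec[of _ _ "Suc j"])
  then show ?case using Suc by (cases "i = j") auto
qed simp

lemma time_grid_le:
  assumes "time_grid T N t" "i \<le> j" "j \<le> N"
  shows "t i \<le> t j"
  using time_grid_less[OF assms(1), of i j] assms(2,3) by (cases "i = j") auto

lemma time_grid_mem:
  assumes "time_grid T N t" "j \<le> N"
  shows "t j \<in> {0..T}"
  using time_grid_le[OF assms(1), of 0 j] time_grid_le[OF assms(1), of j N] assms
  by (simp add: time_grid_def)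

text \<open>The index is the least j with s \<le> t j. It is not 0 because t 0 = 0 < s, and
  minimality puts t (j - 1) below s.\<close>

lemma time_grid_cover:
  assumes grid: "time_grid T N t" and s: "0 < s" "s \<le> T"
  obtains j where "j \<in> {1..N}" "s \<in> {t (j - 1)<..t j}"
proof -
  define j where "j = (LEAST j. s \<le> t j)"
  have N: "s \<le> t N" "t 0 < s" using grid s by (auto simp: time_grid_def)
  then have "s \<le> t j" "j \<le> N" unfolding j_def by (auto intro: LeastI Least_le)
  moreover from this N have "j \<noteq> 0" by (cases "j = 0") auto
  moreover from this have "\<not> s \<le> t (j - 1)"
    unfolding j_def by (intro not_less_Least) simp
  ultimately show ?thesis by (intro that[of j]) auto
qed

lemma sum_time_step:
  assumes "time_grid T N t"
  shows "(\<Sum>j=1..n. time_step t j) = t n"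
  using assms by (induction n) (auto simp: time_grid_def time_step_def)

text \<open>Time 0 lies in none of the half-open intervals, hence the separate term for h 0.\<close>

lemma step_function_expand:
  assumes grid: "time_grid T N t"
    and h: "\<And>j s. j \<in> {1..N} \<Longrightarrow> s \<in> {t (j - 1)<..t j} \<Longrightarrow> h s = (h (t j) :: real)"
    and s: "s \<in> {0..T}"
  shows "h s = indicator {0} s * h 0 + (\<Sum>j=1..N. indicator {t (j - 1)<..t j} s * h (t j))"
proof (cases "s = 0")
  case True
  have "0 \<le> t (j - 1)" if "j \<in> {1..N}" for j
    using time_grid_mem[OF grid, of "j - 1"] that by auto
  then have "(\<Sum>j=1..N. indicator {t (j - 1)<..t j} s * h (t j)) = 0"
    using True by (intro sum.neutral ballI) (force simp: indicator_def)
  then show ?thesis using True by simp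
next
  case False
  then obtain j where j: "j \<in> {1..N}" "s \<in> {t (j - 1)<..t j}"
    using time_grid_cover[OF grid, of s] s by auto
  have "s \<notin> {t (i - 1)<..t i}" if "i \<in> {1..N}" "i \<noteq> j" for i
  proof -
    have "i \<le> j - 1 \<or> j \<le> i - 1" using that by auto
    moreover have "j - 1 \<le> N" "i - 1 \<le> N" using that j by auto
    ultimately have "t i \<le> t (j - 1) \<or> t j \<le> t (i - 1)"
      using time_grid_le[OF grid] by blast
    then show ?thesis using j(2) by auto
  qed
  then have "(\<Sum>i=1..N. indicator {t (i - 1)<..t i} s * h (t i)) = (\<Sum>i=1..N. if i = j then h (t j) else 0)"
    using j(2) by (intro sum.cong) auto
  also have "\<dots> = h s" using h[OF j] j(1) by simp
  finally show ?thesis using False by simp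
qed

text \<open>Measurability and integral are read off from the expansion into indicators. The value h
  0 sits on a null set and drops out of the integral.\<close>

lemma step_function:
  assumes grid: "time_grid T N t"
    and h: "\<And>j s. j \<in> {1..N} \<Longrightarrow> s \<in> {t (j - 1)<..t j} \<Longrightarrow> h s = (h (t j) :: real)"
  shows "h \<in> borel_measurable (lebesgue_on {0..T})"
    and "(LINT s|lebesgue_on {0..T}. h s) = (\<Sum>j=1..N. time_step t j * h (t j))"
proof -
  let ?g = "\<lambda>s. indicator {0} s * h 0 + (\<Sum>j=1..N. indicator {t (j - 1)<..t j} s * h (t j))"
  have eq: "h s = ?g s" if "s \<in> space (lebesgue_on {0..T})" for s
    by (rule step_function_expand[where h=h, OF grid h]) (use that in \<open>simp_all add: space_restrict_space\<close>)
  have T: "0 \<le> T" using time_grid_mem[OF grid, of 0] by simp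
  have int: "integrable (lebesgue_on {0..T}) (\<lambda>s. indicator A s * c)"
    and val: "(LINT s|lebesgue_on {0..T}. indicator A s * c) = measure lebesgue A * c"
    if A: "A \<in> sets borel" "A \<subseteq> {0..T}" for A and c :: real
  proof -
    have sets: "A \<in> sets (lebesgue_on {0..T})" using A by (auto simp: sets_restrict_space)
    have "emeasure lebesgue A \<le> emeasure lebesgue {0..T}"
      using A(2) by (intro emeasure_mono) auto
    also have "\<dots> < \<infinity>" using T by (simp add: ennreal_less_top)
    finally have "emeasure (lebesgue_on {0..T}) A < \<infinity>" 
      using A(2) by (simp add: emeasure_restrict_space)
    then show "integrable (lebesgue_on {0..T}) (\<lambda>s. indicator A s * c)"
      using sets by (intro integrable_mult_left integrable_real_indicator) auto
    show "(LINT s|lebesgue_on {0..T}. indicator A s * c) = measure lebesgue A * c"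
      using sets A by (simp add: measure_restrict_space Int_absorb2 space_restrict_space)
  qed
  have I: "{t (j - 1)<..t j} \<subseteq> {0..T}" if "j \<in> {1..N}" for j
  proof -
    have "j - 1 \<le> N" "j \<le> N" using that by auto
    from this[THEN time_grid_mem[OF grid]] show ?thesis by auto
  qed
  have int_0: "integrable (lebesgue_on {0..T}) (\<lambda>s. indicator {0} s * h 0)"
    using T by (intro int) auto
  have int_j: "integrable (lebesgue_on {0..T}) (\<lambda>s. indicator {t (j - 1)<..t j} s * h (t j))" if "j \<in> {1..N}" for j
    by (rule int[OF _ I[OF that]]) simp
  have int_sum: "integrable (lebesgue_on {0..T}) (\<lambda>s. \<Sum>j=1..N. indicator {t (j - 1)<..t j} s * h (t j))"
    by (rule Bochner_Integration.integrable_sum[OF int_j])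
  have "integrable (lebesgue_on {0..T}) ?g"
    by (rule Bochner_Integration.integrable_add[OF int_0 int_sum])
  then have "?g \<in> borel_measurable (lebesgue_on {0..T})" by (rule borel_measurable_integrable)
  then show "h \<in> borel_measurable (lebesgue_on {0..T})"
    using measurable_cong[of "lebesgue_on {0..T}" h ?g borel, OF eq] by blast
  have "(LINT s|lebesgue_on {0..T}. h s) = (LINT s|lebesgue_on {0..T}. ?g s)"
    by (rule Bochner_Integration.integral_cong[OF refl eq])
  also have "\<dots> = (LINT s|lebesgue_on {0..T}. indicator {0} s * h 0)
      + (\<Sum>j=1..N. LINT s|lebesgue_on {0..T}. indicator {t (j - 1)<..t j} s * h (t j))"
    unfolding Bochner_Integration.integral_add[OF int_0 int_sum]
    using Bochner_Integration.integral_sum[of "{1..N}" "lebesgue_on {0..T}", OF int_j] by presburger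
  also have "\<dots> = (\<Sum>j=1..N. measure lebesgue {t (j - 1)<..t j} * h (t j))"
  proof -
    have "(LINT s|lebesgue_on {0..T}. indicator {0} s * h 0) = 0"
      using val[of "{0}" "h 0"] T by simp
    moreover have "(LINT s|lebesgue_on {0..T}. indicator {t (j - 1)<..t j} s * h (t j))
        = measure lebesgue {t (j - 1)<..t j} * h (t j)" if "j \<in> {1..N}" for j
      by (rule val[OF _ I[OF that]]) simp
    ultimately show ?thesis by (simp only: add_0 cong: sum.cong)
  qed
  also have "\<dots> = (\<Sum>j=1..N. time_step t j * h (t j))"
  proof (rule sum.cong[OF refl])
    fix j assume "j \<in> {1..N}"
    then have "t (j - 1) \<le> t j" using time_grid_le[OF grid, of "j - 1" j] by auto
    then show "measure lebesgue {t (j - 1)<..t j} * h (t j) = time_step t j * h (t j)"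
      by (simp add: time_step_def)
  qed
  finally show "(LINT s|lebesgue_on {0..T}. h s) = (\<Sum>j=1..N. time_step t j * h (t j))" .
qed

lemma step_function_L2_time_norm:
  assumes grid: "time_grid T N t"
    and h: "\<And>j s. j \<in> {1..N} \<Longrightarrow> s \<in> {t (j - 1)<..t j} \<Longrightarrow> h s = h (t j)"
  shows "L2_time_norm T h = sqrt (\<Sum>j=1..N. time_step t j * (h (t j))\<^sup>2)"
proof -
  have "(h s)\<^sup>2 = (h (t j))\<^sup>2" if "j \<in> {1..N}" "s \<in> {t (j - 1)<..t j}" for j s
    using h[OF that] by simp
  from step_function(2)[where h="\<lambda>s. (h s)\<^sup>2", OF grid this] show ?thesis by (simp add: L2_time_norm_def)
qed

section \<open>Energy estimate for one time step\<close>

context bounded_open_set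
begin

text \<open>Continuity of F gives measurability of the composition and linear growth gives square
  integrability. It makes A' of a weak gradient an L2 function.\<close>

lemma nemytskii_L2:
  assumes "continuous_on UNIV F" "\<And>p. norm (F p) \<le> C * norm p" "g \<in> L2 \<Omega>"
  shows "(\<lambda>x. F (g x)) \<in> L2 \<Omega>"
proof (rule L2_dominated[OF assms(3)])
  have "g \<in> borel_measurable (lebesgue_on \<Omega>)" using assms(3) by (simp add: L2_def)
  then show "(\<lambda>x. F (g x)) \<in> borel_measurable (lebesgue_on \<Omega>)"
    by (rule measurable_compose[OF _ borel_measurable_continuous_onI[OF assms(1)]])
qed (rule assms(2))

text \<open>In the doubled difference equation, one of the two copies of the squared norm of e
  absorbs the part from z. Of the doubled gradient term, one copy remains and the other absorbs
  \<delta> times it, as \<delta> \<le> \<open>C\<^sub>A\<close>.\<close>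

lemma energy_step:
  fixes y\<^sub>1 y\<^sub>2 z\<^sub>1 z\<^sub>2 u\<^sub>1 u\<^sub>2 :: "'a \<Rightarrow> real"
  assumes A': "continuous_on UNIV A'" "\<And>p. norm (A' p) \<le> K * norm p"
      "\<And>p q. (A' p - A' q) \<bullet> (p - q) \<ge> C\<^sub>A * (norm (p - q))\<^sup>2"
    and \<psi>': "\<And>a b. - C\<^sub>\<psi> * (a - b)\<^sup>2 \<le> (\<psi>' a - \<psi>' b) * (a - b)"
    and y: "y\<^sub>1 \<in> H1 \<Omega>" "y\<^sub>2 \<in> H1 \<Omega>" and z: "z\<^sub>1 \<in> L2 \<Omega>" "z\<^sub>2 \<in> L2 \<Omega>" and u: "u\<^sub>1 \<in> L2 \<Omega>" "u\<^sub>2 \<in> L2 \<Omega>"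
    and \<tau>: "0 \<le> \<tau>" and \<delta>: "0 < \<delta>" "\<delta> \<le> C\<^sub>A"
    and eq1: "\<And>\<phi>. \<phi> \<in> H1 \<Omega> \<Longrightarrow> integrable (lebesgue_on \<Omega>) (\<lambda>x. \<psi>' (y\<^sub>1 x) * \<phi> x) \<and>
      L2_inner \<Omega> y\<^sub>1 \<phi> + \<tau> * L2_inner \<Omega> (\<lambda>x. A' (weak_grad \<Omega> y\<^sub>1 x)) (weak_grad \<Omega> \<phi>)
        + \<tau> * L2_inner \<Omega> (\<lambda>x. \<psi>' (y\<^sub>1 x)) \<phi> = \<tau> * L2_inner \<Omega> u\<^sub>1 \<phi> + L2_inner \<Omega> z\<^sub>1 \<phi>"
    and eq2: "\<And>\<phi>. \<phi> \<in> H1 \<Omega> \<Longrightarrow> integrable (lebesgue_on \<Omega>) (\<lambda>x. \<psi>' (y\<^sub>2 x) * \<phi> x) \<and>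
      L2_inner \<Omega> y\<^sub>2 \<phi> + \<tau> * L2_inner \<Omega> (\<lambda>x. A' (weak_grad \<Omega> y\<^sub>2 x)) (weak_grad \<Omega> \<phi>)
        + \<tau> * L2_inner \<Omega> (\<lambda>x. \<psi>' (y\<^sub>2 x)) \<phi> = \<tau> * L2_inner \<Omega> u\<^sub>2 \<phi> + L2_inner \<Omega> z\<^sub>2 \<phi>"
  shows "(1 - (2 * C\<^sub>\<psi> + \<delta>) * \<tau>) * (L2_norm \<Omega> (\<lambda>x. y\<^sub>1 x - y\<^sub>2 x))\<^sup>2
      + C\<^sub>A * (\<tau> * (L2_norm \<Omega> (\<lambda>x. weak_grad \<Omega> y\<^sub>1 x - weak_grad \<Omega> y\<^sub>2 x))\<^sup>2)
    \<le> (L2_norm \<Omega> (\<lambda>x. z\<^sub>1 x - z\<^sub>2 x))\<^sup>2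
      + \<tau> * (H1_dual_norm \<Omega> (L2_inner \<Omega> (\<lambda>x. u\<^sub>1 x - u\<^sub>2 x)))\<^sup>2 / \<delta>"
proof -
  let ?M = "lebesgue_on \<Omega>"
  define e where "e = (\<lambda>x. y\<^sub>1 x - y\<^sub>2 x)"
  define z where "z = (\<lambda>x. z\<^sub>1 x - z\<^sub>2 x)"
  define w where "w = (\<lambda>x. u\<^sub>1 x - u\<^sub>2 x)"
  define g where "g = (\<lambda>x. weak_grad \<Omega> y\<^sub>1 x - weak_grad \<Omega> y\<^sub>2 x)"
  note grad1 = weak_grad(1)[OF y(1)] and grad2 = weak_grad(1)[OF y(2)]
  have e: "e \<in> H1 \<Omega>" and grad_e: "AE x in ?M. weak_grad \<Omega> e x = g x"
    unfolding e_def g_def by (rule H1_diff[OF y])+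
  have zL: "z \<in> L2 \<Omega>" and wL: "w \<in> L2 \<Omega>" and gL: "g \<in> L2 \<Omega>"
    unfolding z_def w_def g_def by (rule L2_diff assms(7-) grad1 grad2)+
  note eL = H1_L2[OF e] and grad_eL = weak_grad(1)[OF e]
  note A1 = nemytskii_L2[OF A'(1,2) grad1] and A2 = nemytskii_L2[OF A'(1,2) grad2]
  have norm_g: "L2_norm \<Omega> (weak_grad \<Omega> e) = L2_norm \<Omega> g"
    using grad_e grad_eL gL by (intro L2_norm_cong_AE) (auto simp: L2_def)
  have e_inner: "L2_inner \<Omega> y\<^sub>1 e - L2_inner \<Omega> y\<^sub>2 e = (L2_norm \<Omega> e)\<^sup>2"
    using L2_inner_diff_left[OF H1_L2[OF y(1)] H1_L2[OF y(2)] eL] by (simp add: L2_inner_self flip: e_def)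
  have z_inner: "L2_inner \<Omega> z\<^sub>1 e - L2_inner \<Omega> z\<^sub>2 e = L2_inner \<Omega> z e"
    unfolding z_def using z eL by (intro L2_inner_diff_left[symmetric])
  have w_inner: "L2_inner \<Omega> u\<^sub>1 e - L2_inner \<Omega> u\<^sub>2 e = L2_inner \<Omega> w e"
    unfolding w_def using u eL by (intro L2_inner_diff_left[symmetric])
  have A_ge: "C\<^sub>A * (L2_norm \<Omega> g)\<^sup>2 \<le> L2_inner \<Omega> (\<lambda>x. A' (weak_grad \<Omega> y\<^sub>1 x)) (weak_grad \<Omega> e)
      - L2_inner \<Omega> (\<lambda>x. A' (weak_grad \<Omega> y\<^sub>2 x)) (weak_grad \<Omega> e)"
  proof -
    have "C\<^sub>A * (L2_norm \<Omega> g)\<^sup>2 = (LINT x|?M. C\<^sub>A * (norm (g x))\<^sup>2)"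
      by (simp add: L2_norm_def)
    also have "\<dots> \<le> (LINT x|?M. (A' (weak_grad \<Omega> y\<^sub>1 x) - A' (weak_grad \<Omega> y\<^sub>2 x)) \<bullet> weak_grad \<Omega> e x)"
    proof (rule integral_mono_AE)
      show "integrable ?M (\<lambda>x. C\<^sub>A * (norm (g x))\<^sup>2)" using gL by (simp add: L2_def)
      show "integrable ?M (\<lambda>x. (A' (weak_grad \<Omega> y\<^sub>1 x) - A' (weak_grad \<Omega> y\<^sub>2 x)) \<bullet> weak_grad \<Omega> e x)"
        by (rule integrable_L2_inner[OF L2_diff[OF A1 A2] grad_eL])
      show "AE x in ?M. C\<^sub>A * (norm (g x))\<^sup>2
          \<le> (A' (weak_grad \<Omega> y\<^sub>1 x) - A' (weak_grad \<Omega> y\<^sub>2 x)) \<bullet> weak_grad \<Omega> e x"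
        using grad_e by eventually_elim (simp add: g_def A'(3))
    qed
    also have "\<dots> = L2_inner \<Omega> (\<lambda>x. A' (weak_grad \<Omega> y\<^sub>1 x)) (weak_grad \<Omega> e)
        - L2_inner \<Omega> (\<lambda>x. A' (weak_grad \<Omega> y\<^sub>2 x)) (weak_grad \<Omega> e)"
      using L2_inner_diff_left[OF A1 A2 grad_eL] by (simp add: L2_inner_def)
    finally show ?thesis .
  qed
  \<comment> \<open>As \<psi>' of a solution need not be in L2, the integrals are split by means of
    the integrability clause of the equations, taken at \<phi> = e.\<close>
  have \<psi>_ge: "- C\<^sub>\<psi> * (L2_norm \<Omega> e)\<^sup>2
      \<le> L2_inner \<Omega> (\<lambda>x. \<psi>' (y\<^sub>1 x)) e - L2_inner \<Omega> (\<lambda>x. \<psi>' (y\<^sub>2 x)) e"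
  proof -
    have "- C\<^sub>\<psi> * (L2_norm \<Omega> e)\<^sup>2 = (LINT x|?M. - C\<^sub>\<psi> * (e x)\<^sup>2)"
      by (simp add: L2_norm_def)
    also have "\<dots> \<le> (LINT x|?M. \<psi>' (y\<^sub>1 x) * e x - \<psi>' (y\<^sub>2 x) * e x)"
    proof (rule integral_mono)
      show "integrable ?M (\<lambda>x. - C\<^sub>\<psi> * (e x)\<^sup>2)" using eL by (simp add: L2_def)
      show "integrable ?M (\<lambda>x. \<psi>' (y\<^sub>1 x) * e x - \<psi>' (y\<^sub>2 x) * e x)"
        using eq1[OF e] eq2[OF e] by simp
      show "- C\<^sub>\<psi> * (e x)\<^sup>2 \<le> \<psi>' (y\<^sub>1 x) * e x - \<psi>' (y\<^sub>2 x) * e x" for x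
        using \<psi>'[of "y\<^sub>1 x" "y\<^sub>2 x"] by (simp add: e_def left_diff_distrib)
    qed
    also have "\<dots> = L2_inner \<Omega> (\<lambda>x. \<psi>' (y\<^sub>1 x)) e - L2_inner \<Omega> (\<lambda>x. \<psi>' (y\<^sub>2 x)) e"
      using eq1[OF e] eq2[OF e] by (simp add: L2_inner_def)
    finally show ?thesis .
  qed
  let ?D = "H1_dual_norm \<Omega> (L2_inner \<Omega> w)"
  let ?E = "(L2_norm \<Omega> e)\<^sup>2" and ?G = "(L2_norm \<Omega> g)\<^sup>2"
  \<comment> \<open>Young's inequality with weight \<delta>, obtained from the square of
    \<open>?D - \<delta> * H1_norm \<Omega> e\<close> divided by \<delta>.\<close>
  have w_le: "2 * L2_inner \<Omega> w e \<le> ?D\<^sup>2 / \<delta> + \<delta> * (?E + ?G)"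
  proof -
    have "2 * L2_inner \<Omega> w e \<le> 2 * (?D * H1_norm \<Omega> e)"
      using L2_inner_le_H1_dual_norm[OF wL e] by simp
    also have "\<dots> \<le> ?D\<^sup>2 / \<delta> + \<delta> * (H1_norm \<Omega> e)\<^sup>2"
    proof -
      have "0 \<le> (?D - \<delta> * H1_norm \<Omega> e)\<^sup>2 / \<delta>" using \<delta> by simp
      also have "\<dots> = ?D\<^sup>2 / \<delta> - 2 * (?D * H1_norm \<Omega> e) + \<delta> * (H1_norm \<Omega> e)\<^sup>2"
        using \<delta> by (simp add: power2_eq_square field_simps)
      finally show ?thesis by simp
    qed
    also have "(H1_norm \<Omega> e)\<^sup>2 = ?E + ?G" by (simp add: H1_norm_def norm_g)
    finally show ?thesis .
  qed
  have "?E + \<tau> * (L2_inner \<Omega> (\<lambda>x. A' (weak_grad \<Omega> y\<^sub>1 x)) (weak_grad \<Omega> e)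
        - L2_inner \<Omega> (\<lambda>x. A' (weak_grad \<Omega> y\<^sub>2 x)) (weak_grad \<Omega> e))
      + \<tau> * (L2_inner \<Omega> (\<lambda>x. \<psi>' (y\<^sub>1 x)) e - L2_inner \<Omega> (\<lambda>x. \<psi>' (y\<^sub>2 x)) e)
      = \<tau> * L2_inner \<Omega> w e + L2_inner \<Omega> z e"
    using eq1[OF e] eq2[OF e] unfolding e_inner[symmetric] z_inner[symmetric] w_inner[symmetric]
    by (simp add: right_diff_distrib)
  moreover have "\<tau> * (C\<^sub>A * ?G) \<le> \<tau> * (L2_inner \<Omega> (\<lambda>x. A' (weak_grad \<Omega> y\<^sub>1 x)) (weak_grad \<Omega> e)
        - L2_inner \<Omega> (\<lambda>x. A' (weak_grad \<Omega> y\<^sub>2 x)) (weak_grad \<Omega> e))"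
    by (rule mult_left_mono[OF A_ge \<tau>])
  moreover have "\<tau> * (- C\<^sub>\<psi> * ?E) \<le> \<tau> * (L2_inner \<Omega> (\<lambda>x. \<psi>' (y\<^sub>1 x)) e - L2_inner \<Omega> (\<lambda>x. \<psi>' (y\<^sub>2 x)) e)"
    by (rule mult_left_mono[OF \<psi>_ge \<tau>])
  ultimately have "2 * ?E + 2 * (\<tau> * (C\<^sub>A * ?G)) + 2 * (\<tau> * (- C\<^sub>\<psi> * ?E))
      \<le> \<tau> * (2 * L2_inner \<Omega> w e) + 2 * L2_inner \<Omega> z e"
    by simp
  also have "\<dots> \<le> \<tau> * (?D\<^sup>2 / \<delta> + \<delta> * (?E + ?G)) + ((L2_norm \<Omega> z)\<^sup>2 + ?E)"
    using L2_inner_le[OF zL eL] by (intro add_mono mult_left_mono[OF w_le \<tau>]) simp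
  finally have "(1 - (2 * C\<^sub>\<psi> + \<delta>) * \<tau>) * ?E + C\<^sub>A * (\<tau> * ?G) + (C\<^sub>A - \<delta>) * (\<tau> * ?G)
      \<le> (L2_norm \<Omega> z)\<^sup>2 + \<tau> * ?D\<^sup>2 / \<delta>"
    by (simp add: algebra_simps)
  moreover have "0 \<le> (C\<^sub>A - \<delta>) * (\<tau> * ?G)" using \<delta> \<tau> by simp
  ultimately show ?thesis unfolding e_def z_def w_def g_def by linarith
qed

end


section \<open>Stability\<close>

text \<open>As \<delta> \<le> 1/2, the rate l = \<open>2 * C\<^sub>\<psi> + \<delta>\<close>
  satisfies l \<tau> \<le> q for every step \<tau>, with q =
  \<open>l / (1 + 2 * C\<^sub>\<psi>)\<close> < 1. So \<mu> = l / (1 - q) is the Gronwall rate, and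
  the square of K' is the Gronwall factor at time T divided by \<delta>.\<close>

lemma (in bounded_open_set) discrete_stability:
  fixes y\<^sub>1 y\<^sub>2 u\<^sub>1 u\<^sub>2 :: "real \<Rightarrow> 'a \<Rightarrow> real"
  assumes T: "0 < T" and C: "0 < C\<^sub>A" "0 \<le> C\<^sub>\<psi>"
    and A': "continuous_on UNIV A'" "\<And>p. norm (A' p) \<le> K * norm p"
      "\<And>p q. (A' p - A' q) \<bullet> (p - q) \<ge> C\<^sub>A * (norm (p - q))\<^sup>2"
    and \<psi>': "\<And>a b. - C\<^sub>\<psi> * (a - b)\<^sup>2 \<le> (\<psi>' a - \<psi>' b) * (a - b)"
    and grid: "time_grid T N t" and max: "max_step N t \<le> 1 / (1 + 2 * C\<^sub>\<psi>)"
    and y0: "y\<^sub>0\<^sub>1 \<in> H1 \<Omega>" "y\<^sub>0\<^sub>2 \<in> H1 \<Omega>"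
    and u: "u\<^sub>1 \<in> U_space \<Omega> T N t" "u\<^sub>2 \<in> U_space \<Omega> T N t"
    and S: "S_tau_graph \<Omega> A' \<psi>' T N t y\<^sub>0\<^sub>1 u\<^sub>1 y\<^sub>1" "S_tau_graph \<Omega> A' \<psi>' T N t y\<^sub>0\<^sub>2 u\<^sub>2 y\<^sub>2"
    and \<delta>_def: "\<delta> = min C\<^sub>A (1 / 2)" and \<mu>_def: "\<mu> = (2 * C\<^sub>\<psi> + \<delta>) / (1 - (2 * C\<^sub>\<psi> + \<delta>) / (1 + 2 * C\<^sub>\<psi>))"
    and K_def: "K' = sqrt (exp (\<mu> * T) / \<delta>)"
  shows "Linf_time_norm T (\<lambda>s. L2_norm \<Omega> (\<lambda>x. y\<^sub>1 s x - y\<^sub>2 s x))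
         + ereal (L2_time_norm T (\<lambda>s. L2_norm \<Omega> (\<lambda>x. weak_grad \<Omega> (y\<^sub>1 s) x - weak_grad \<Omega> (y\<^sub>2 s) x)))
       \<le> ereal ((K' + K' / sqrt C\<^sub>A) * (L2_norm \<Omega> (\<lambda>x. y\<^sub>0\<^sub>1 x - y\<^sub>0\<^sub>2 x)
           + L2_time_norm T (\<lambda>s. H1_dual_norm \<Omega> (L2_inner \<Omega> (\<lambda>x. u\<^sub>1 s x - u\<^sub>2 s x)))))"
proof -
  have t0: "t 0 = 0" and tN: "t N = T" using grid by (auto simp: time_grid_def)
  have y_H1: "y\<^sub>1 s \<in> H1 \<Omega>" "y\<^sub>2 s \<in> H1 \<Omega>" if "s \<in> {0..T}" for s
    using S that by (auto simp: S_tau_graph_def Y_space_def)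
  have u_L2: "u\<^sub>1 s \<in> L2 \<Omega>" "u\<^sub>2 s \<in> L2 \<Omega>" if "s \<in> {0..T}" for s
    using u that by (auto simp: U_space_def)
  have mem: "t j \<in> {t (j - 1)<..t j}" "t j \<in> {0..T}" "t (j - 1) \<in> {0..T}" "{t (j - 1)<..t j} \<subseteq> {0..T}"
    if j: "j \<in> {1..N}" for j
  proof -
    have "j - 1 \<le> N" "j \<le> N" "j - 1 < j" using j by auto
    note this(1,2)[THEN time_grid_mem[OF grid]] time_grid_less[OF grid this(3,2)]
    then show "t j \<in> {t (j - 1)<..t j}" "t j \<in> {0..T}" "t (j - 1) \<in> {0..T}" "{t (j - 1)<..t j} \<subseteq> {0..T}"
      by auto
  qed
  \<comment> \<open>Constancy in time holds for almost every x, with one null set for all times;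
    fixing s turns it into an almost everywhere equality of two functions of x.\<close>
  have step_AE: "AE x in lebesgue_on \<Omega>. v s x = v (t j) x"
    if v: "AE x in lebesgue_on \<Omega>. \<forall>j\<in>{1..N}. (\<lambda>s. v s x) constant_on {t (j - 1)<..t j}"
      and j: "j \<in> {1..N}" and s: "s \<in> {t (j - 1)<..t j}" for v :: "real \<Rightarrow> 'a \<Rightarrow> real" and j s
    using v
  proof eventually_elim
    case (elim x)
    with j have "(\<lambda>s. v s x) constant_on {t (j - 1)<..t j}" by blast
    with s mem(1)[OF j] show ?case by (auto simp: constant_on_def)
  qed
  have y_step: "AE x in lebesgue_on \<Omega>. y\<^sub>1 s x = y\<^sub>1 (t j) x" "AE x in lebesgue_on \<Omega>. y\<^sub>2 s x = y\<^sub>2 (t j) x"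
    and u_step: "AE x in lebesgue_on \<Omega>. u\<^sub>1 s x = u\<^sub>1 (t j) x" "AE x in lebesgue_on \<Omega>. u\<^sub>2 s x = u\<^sub>2 (t j) x"
    if "j \<in> {1..N}" "s \<in> {t (j - 1)<..t j}" for j s
    using S u by (auto intro!: step_AE[OF _ that] simp: S_tau_graph_def Y_space_def U_space_def)

  define E where "E s = L2_norm \<Omega> (\<lambda>x. y\<^sub>1 s x - y\<^sub>2 s x)" for s
  define G where "G s = L2_norm \<Omega> (\<lambda>x. weak_grad \<Omega> (y\<^sub>1 s) x - weak_grad \<Omega> (y\<^sub>2 s) x)" for s
  define D where "D s = H1_dual_norm \<Omega> (L2_inner \<Omega> (\<lambda>x. u\<^sub>1 s x - u\<^sub>2 s x))" for s
  define E0 where "E0 = L2_norm \<Omega> (\<lambda>x. y\<^sub>0\<^sub>1 x - y\<^sub>0\<^sub>2 x)"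
  \<comment> \<open>Norms do not see null sets, so E, G and D are step functions exactly, at every
    time. For G this rests on the equality of the chosen weak gradients.\<close>
  have E_step: "E s = E (t j)" and G_step: "G s = G (t j)" and D_step: "D s = D (t j)"
    if j: "j \<in> {1..N}" and s: "s \<in> {t (j - 1)<..t j}" for j s
  proof -
    have sT: "s \<in> {0..T}" using mem(4)[OF j] s by blast
    note tT = mem(2)[OF j]
    note yL2 = y_H1[OF sT, THEN H1_L2] y_H1[OF tT, THEN H1_L2]
    have "AE x in lebesgue_on \<Omega>. y\<^sub>1 s x - y\<^sub>2 s x = y\<^sub>1 (t j) x - y\<^sub>2 (t j) x"
      using y_step[OF that] by eventually_elim simp
    with L2_diff[OF yL2(1,2)] L2_diff[OF yL2(3,4)] show "E s = E (t j)"
      unfolding E_def by (intro L2_norm_cong_AE) (simp_all add: L2_def)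
    show "G s = G (t j)"
      unfolding G_def using weak_grad_cong_AE[OF yL2(1,3) y_step(1)[OF that]]
        weak_grad_cong_AE[OF yL2(2,4) y_step(2)[OF that]] by simp
    have "AE x in lebesgue_on \<Omega>. u\<^sub>1 s x - u\<^sub>2 s x = u\<^sub>1 (t j) x - u\<^sub>2 (t j) x"
      using u_step[OF that] by eventually_elim simp
    then have "L2_inner \<Omega> (\<lambda>x. u\<^sub>1 s x - u\<^sub>2 s x) \<phi> = L2_inner \<Omega> (\<lambda>x. u\<^sub>1 (t j) x - u\<^sub>2 (t j) x) \<phi>"
      if "\<phi> \<in> H1 \<Omega>" for \<phi>
      by (intro L2_inner_cong_AE L2_diff u_L2 sT tT H1_L2[OF that]) auto
    then show "D s = D (t j)"
      unfolding D_def H1_dual_norm_def by (intro SUP_cong) auto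
  qed
  have E_0: "E 0 = E0"
    unfolding E_def E0_def
  proof (rule L2_norm_cong_AE)
    have "0 \<in> {0..T}" using T by simp
    then show "(\<lambda>x. y\<^sub>1 0 x - y\<^sub>2 0 x) \<in> borel_measurable (lebesgue_on \<Omega>)"
      using L2_diff[OF y_H1[THEN H1_L2]] by (simp add: L2_def)
    show "(\<lambda>x. y\<^sub>0\<^sub>1 x - y\<^sub>0\<^sub>2 x) \<in> borel_measurable (lebesgue_on \<Omega>)"
      using L2_diff[OF y0[THEN H1_L2]] by (simp add: L2_def)
    have "AE x in lebesgue_on \<Omega>. y\<^sub>1 0 x = y\<^sub>0\<^sub>1 x" "AE x in lebesgue_on \<Omega>. y\<^sub>2 0 x = y\<^sub>0\<^sub>2 x"
      using S by (auto simp: S_tau_graph_def)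
    then show "AE x in lebesgue_on \<Omega>. y\<^sub>1 0 x - y\<^sub>2 0 x = y\<^sub>0\<^sub>1 x - y\<^sub>0\<^sub>2 x"
      by eventually_elim simp
  qed

  \<comment> \<open>Gronwall bound and passage to the norms in time\<close>
  have \<delta>: "0 < \<delta>" "\<delta> \<le> C\<^sub>A" "\<delta> \<le> 1 / 2" using C by (auto simp: \<delta>_def)
  let ?l = "2 * C\<^sub>\<psi> + \<delta>"
  have tau: "0 \<le> time_step t j" "time_step t j \<le> 1 / (1 + 2 * C\<^sub>\<psi>)" if j: "j \<in> {1..N}" for j
  proof -
    show "0 \<le> time_step t j" using mem(1)[OF j] by (simp add: time_step_def)
    have "time_step t j \<le> max_step N t" unfolding max_step_def using j by (intro Max_ge) auto
    with max show "time_step t j \<le> 1 / (1 + 2 * C\<^sub>\<psi>)" by simp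
  qed
  \<comment> \<open>The estimate is kept for every n \<le> N: the maximum norm needs all nodes, the
    gradient norm only n = N.\<close>
  have gronwall: "(E (t n))\<^sup>2 + (\<Sum>j=1..n. C\<^sub>A * (time_step t j * (G (t j))\<^sup>2))
      \<le> exp (\<mu> * (\<Sum>j=1..n. time_step t j)) * ((E (t 0))\<^sup>2 + (\<Sum>j=1..n. time_step t j * (D (t j))\<^sup>2 / \<delta>))"
    if "n \<le> N" for n
    unfolding \<mu>_def
  proof (rule discrete_gronwall[where N=N])
    fix j assume j: "j \<in> {1..N}"
    show "(1 - ?l * time_step t j) * (E (t j))\<^sup>2 + C\<^sub>A * (time_step t j * (G (t j))\<^sup>2)
        \<le> (E (t (j - 1)))\<^sup>2 + time_step t j * (D (t j))\<^sup>2 / \<delta>"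
      unfolding E_def G_def D_def
      by (rule energy_step[OF A' \<psi>'])
        (use j S mem(2,3)[OF j] y_H1 u_L2 tau \<delta> in \<open>auto simp: S_tau_graph_def intro!: H1_L2\<close>)
    have "?l * time_step t j \<le> ?l * (1 / (1 + 2 * C\<^sub>\<psi>))"
      using C \<delta> by (intro mult_left_mono tau j) simp
    then show "?l * time_step t j \<le> ?l / (1 + 2 * C\<^sub>\<psi>)" by simp
  qed (use C \<delta> tau that in \<open>auto simp: divide_simps\<close>)
  have \<mu>: "0 \<le> \<mu>" using C \<delta> unfolding \<mu>_def by (intro divide_nonneg_nonneg) (auto simp: divide_simps)
  let ?D = "L2_time_norm T D" and ?G = "L2_time_norm T G"
  have square_sum: "0 \<le> (\<Sum>j=1..N. time_step t j * (h j)\<^sup>2)" for h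
    using tau by (intro sum_nonneg mult_nonneg_nonneg) auto
  have D_norm: "(\<Sum>j=1..N. time_step t j * (D (t j))\<^sup>2) = ?D\<^sup>2" and D_nonneg: "0 \<le> ?D"
    using step_function_L2_time_norm[where h=D, OF grid D_step] square_sum by simp_all
  have G_norm: "(\<Sum>j=1..N. time_step t j * (G (t j))\<^sup>2) = ?G\<^sup>2"
    using step_function_L2_time_norm[where h=G, OF grid G_step] square_sum by simp
  have E0: "0 \<le> E0" by (simp add: E0_def L2_norm_nonneg)
  have K': "0 \<le> K'" "K'\<^sup>2 = exp (\<mu> * T) / \<delta>" using \<delta> by (auto simp: K_def)
  have bound: "exp (\<mu> * (\<Sum>j=1..n. time_step t j)) * ((E (t 0))\<^sup>2 + (\<Sum>j=1..n. time_step t j * (D (t j))\<^sup>2 / \<delta>))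
      \<le> (K' * (E0 + ?D))\<^sup>2" if n: "n \<le> N" for n
  proof -
    have "(\<Sum>j=1..n. time_step t j * (D (t j))\<^sup>2 / \<delta>) \<le> (\<Sum>j=1..N. time_step t j * (D (t j))\<^sup>2 / \<delta>)"
      using n tau \<delta> by (intro sum_mono2) auto
    also have "\<dots> = ?D\<^sup>2 / \<delta>" unfolding D_norm[symmetric] by (rule sum_divide_distrib[symmetric])
    finally have D: "(\<Sum>j=1..n. time_step t j * (D (t j))\<^sup>2 / \<delta>) \<le> ?D\<^sup>2 / \<delta>" .
    \<comment> \<open>Since \<delta> \<le> 1, the initial error may also be divided by \<delta>,
      which gives both data terms the same constant.\<close>
    have E: "(E (t 0))\<^sup>2 \<le> E0\<^sup>2 / \<delta>"
      using \<delta> mult_left_le[of \<delta> "E0\<^sup>2"] by (simp add: t0 E_0 pos_le_divide_eq)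
    have "(E (t 0))\<^sup>2 + (\<Sum>j=1..n. time_step t j * (D (t j))\<^sup>2 / \<delta>) \<le> (E0 + ?D)\<^sup>2 / \<delta>"
    proof -
      have "E0\<^sup>2 + ?D\<^sup>2 \<le> (E0 + ?D)\<^sup>2" using E0 D_nonneg by (simp add: power2_sum)
      then have "(E0\<^sup>2 + ?D\<^sup>2) / \<delta> \<le> (E0 + ?D)\<^sup>2 / \<delta>" using \<delta> by (intro divide_right_mono) auto
      then show ?thesis using D E by (simp add: add_divide_distrib)
    qed
    moreover have "exp (\<mu> * (\<Sum>j=1..n. time_step t j)) \<le> exp (\<mu> * T)"
      unfolding sum_time_step[OF grid] using time_grid_mem[OF grid n] \<mu> by (simp add: mult_left_mono)
    ultimately have "exp (\<mu> * (\<Sum>j=1..n. time_step t j)) * ((E (t 0))\<^sup>2 + (\<Sum>j=1..n. time_step t j * (D (t j))\<^sup>2 / \<delta>))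
        \<le> exp (\<mu> * T) * ((E0 + ?D)\<^sup>2 / \<delta>)"
      using n tau \<delta> by (intro mult_mono add_nonneg_nonneg sum_nonneg) auto
    then show ?thesis by (simp add: power_mult_distrib K')
  qed
  have nonneg: "0 \<le> K' * (E0 + ?D)" using K' E0 D_nonneg by simp
  have E_le: "E (t n) \<le> K' * (E0 + ?D)" if n: "n \<le> N" for n
  proof (rule power2_le_imp_le[OF _ nonneg])
    have "0 \<le> (\<Sum>j=1..n. C\<^sub>A * (time_step t j * (G (t j))\<^sup>2))"
      using n tau C by (intro sum_nonneg) auto
    then show "(E (t n))\<^sup>2 \<le> (K' * (E0 + ?D))\<^sup>2"
      using gronwall[OF n] bound[OF n] by linarith
  qed
  \<comment> \<open>At n = N the term E (t N) is dropped and the factor \<open>C\<^sub>A\<close> is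
    divided out; the square root yields K' / sqrt \<open>C\<^sub>A\<close>.\<close>
  have G_le: "?G \<le> K' / sqrt C\<^sub>A * (E0 + ?D)"
  proof (rule power2_le_imp_le)
    have "(E (t N))\<^sup>2 + C\<^sub>A * ?G\<^sup>2 \<le> (K' * (E0 + ?D))\<^sup>2"
      using order_trans[OF gronwall[OF order_refl] bound[OF order_refl]]
      unfolding sum_distrib_left[symmetric] G_norm .
    then have "C\<^sub>A * ?G\<^sup>2 \<le> (K' * (E0 + ?D))\<^sup>2"
      using zero_le_power2[of "E (t N)"] by linarith
    then show "?G\<^sup>2 \<le> (K' / sqrt C\<^sub>A * (E0 + ?D))\<^sup>2"
      using C by (simp add: power_mult_distrib power_divide pos_le_divide_eq mult.commute)
    show "0 \<le> K' / sqrt C\<^sub>A * (E0 + ?D)" using K' E0 D_nonneg C by simp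
  qed
  have "Linf_time_norm T E \<le> ereal (K' * (E0 + ?D))"
    unfolding Linf_time_norm_def
  proof (rule esssup_I)
    show "(\<lambda>s. ereal (E s)) \<in> borel_measurable (lebesgue_on {0..T})"
      using step_function(1)[where h=E, OF grid E_step] by simp
    \<comment> \<open>Time 0 belongs to no interval and is covered by the node bound with n = 0; any
      other time reduces to the right end point of its interval.\<close>
    have "E s \<le> K' * (E0 + ?D)" if s: "s \<in> {0..T}" for s
    proof (cases "s = 0")
      case True
      then show ?thesis using E_le[of 0] t0 by simp
    next
      case False
      then obtain j where j: "j \<in> {1..N}" "s \<in> {t (j - 1)<..t j}"
        using time_grid_cover[OF grid, of s] s by auto
      then show ?thesis using E_le[of j] E_step[OF j] by simp
    qed
    then show "AE s in lebesgue_on {0..T}. ereal (E s) \<le> ereal (K' * (E0 + ?D))"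
      by (intro AE_I2) (simp add: space_restrict_space)
  qed
  then have "Linf_time_norm T E + ereal ?G \<le> ereal (K' * (E0 + ?D)) + ereal (K' / sqrt C\<^sub>A * (E0 + ?D))"
    using G_le by (intro add_mono) auto
  also have "\<dots> = ereal ((K' + K' / sqrt C\<^sub>A) * (E0 + ?D))"
    by (simp add: distrib_right)
  finally show ?thesis unfolding E_def[abs_def] G_def[abs_def] D_def[abs_def] E0_def .
qed

theorem theorem2p4:
  fixes A :: "'a::euclidean_space \<Rightarrow> real" and A' :: "'a \<Rightarrow> 'a"
    and \<psi> \<psi>' :: "real \<Rightarrow> real"
    and f f' f'' :: "nat \<Rightarrow> real \<Rightarrow> real"
    and C\<^sub>A C\<^sub>A' c C\<^sub>\<psi> T :: real and C\<^sub>n :: "nat \<Rightarrow> real"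
  assumes T: "0 < T"
    and A_C1: "\<And>p. GDERIV A p :> A' p" "continuous_on UNIV A'"
    and A_const: "0 < C\<^sub>A" "0 < C\<^sub>A'"
    and A_mono: "\<And>p q. (A' p - A' q) \<bullet> (p - q) \<ge> C\<^sub>A * (norm (p - q))\<^sup>2"
    and A_growth: "\<And>p. norm (A' p) \<le> C\<^sub>A' * norm p"
    and psi_C1: "\<And>s. (\<psi> has_real_derivative \<psi>' s) (at s)" "continuous_on UNIV \<psi>'"
    and psi_bdd: "bdd_below (range \<psi>)"
    and const: "0 \<le> c" "0 \<le> C\<^sub>\<psi>" "\<And>n. 0 \<le> C\<^sub>n n"
    and f_C2: "\<And>n s. (f n has_real_derivative f' n s) (at s)"
      "\<And>n s. (f' n has_real_derivative f'' n s) (at s)"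
      "\<And>n. continuous_on UNIV (f'' n)"
    and f_lim: "\<And>K. compact K \<Longrightarrow> uniform_limit K f \<psi> sequentially"
      "\<And>K. compact K \<Longrightarrow> uniform_limit K f' \<psi>' sequentially"
    and f_bounds: "\<And>n s. - c \<le> f n s" "\<And>n s. f n s \<le> c * (\<psi> s + 1)"
    and f''_bounds: "\<And>n s. - C\<^sub>\<psi> \<le> f'' n s" "\<And>n s. \<bar>f'' n s\<bar> \<le> C\<^sub>n n"
  shows "\<exists>C::real. \<forall>\<Omega> :: 'a set. bounded_lipschitz_domain \<Omega> \<longrightarrow>
    (\<forall>N t y\<^sub>0\<^sub>1 y\<^sub>0\<^sub>2 u\<^sub>1 u\<^sub>2 y\<^sub>1 y\<^sub>2.
       time_grid T N t \<longrightarrow> max_step N t \<le> 1 / (1 + 2 * C\<^sub>\<psi>) \<longrightarrow>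
       y\<^sub>0\<^sub>1 \<in> H1 \<Omega> \<longrightarrow> integrable (lebesgue_on \<Omega>) (\<lambda>x. \<psi> (y\<^sub>0\<^sub>1 x)) \<longrightarrow>
       y\<^sub>0\<^sub>2 \<in> H1 \<Omega> \<longrightarrow> integrable (lebesgue_on \<Omega>) (\<lambda>x. \<psi> (y\<^sub>0\<^sub>2 x)) \<longrightarrow>
       u\<^sub>1 \<in> U_space \<Omega> T N t \<longrightarrow> u\<^sub>2 \<in> U_space \<Omega> T N t \<longrightarrow>
       S_tau_graph \<Omega> A' \<psi>' T N t y\<^sub>0\<^sub>1 u\<^sub>1 y\<^sub>1 \<longrightarrow> S_tau_graph \<Omega> A' \<psi>' T N t y\<^sub>0\<^sub>2 u\<^sub>2 y\<^sub>2 \<longrightarrow>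
       Linf_time_norm T (\<lambda>s. L2_norm \<Omega> (\<lambda>x. y\<^sub>1 s x - y\<^sub>2 s x))
         + ereal (L2_time_norm T (\<lambda>s. L2_norm \<Omega> (\<lambda>x. weak_grad \<Omega> (y\<^sub>1 s) x - weak_grad \<Omega> (y\<^sub>2 s) x)))
       \<le> ereal (C * (L2_norm \<Omega> (\<lambda>x. y\<^sub>0\<^sub>1 x - y\<^sub>0\<^sub>2 x)
           + L2_time_norm T (\<lambda>s. H1_dual_norm \<Omega> (L2_inner \<Omega> (\<lambda>x. u\<^sub>1 s x - u\<^sub>2 s x))))))"
proof -
  define \<delta> where "\<delta> = min C\<^sub>A (1 / 2)"
  define \<mu> where "\<mu> = (2 * C\<^sub>\<psi> + \<delta>) / (1 - (2 * C\<^sub>\<psi> + \<delta>) / (1 + 2 * C\<^sub>\<psi>))"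
  define K where "K = sqrt (exp (\<mu> * T) / \<delta>)"
  \<comment> \<open>Uniform convergence on the compact set {s} is convergence at s.\<close>
  have "(\<lambda>n. f' n s) \<longlonglongrightarrow> \<psi>' s" for s
    using tendsto_uniform_limitI[OF f_lim(2)[of "{s}"]] by simp
  then have \<psi>': "- C\<^sub>\<psi> * (a - b)\<^sup>2 \<le> (\<psi>' a - \<psi>' b) * (a - b)" for a b
    by (rule one_sided_lipschitz_limit[OF f_C2(2) f''_bounds(1)])
  show ?thesis
  \<comment> \<open>The witness is built from \<open>C\<^sub>A\<close>,
    \<open>C\<^sub>\<psi>\<close> and T alone and is fixed before the domain, the grid and the data;
    this is the independence of the step size.\<close>
  proof (intro exI[of _ "K + K / sqrt C\<^sub>A"] allI impI)
    fix \<Omega> :: "'a set" and N t y\<^sub>0\<^sub>1 y\<^sub>0\<^sub>2 u\<^sub>1 u\<^sub>2 y\<^sub>1 y\<^sub>2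
    assume "bounded_lipschitz_domain \<Omega>"
    then interpret bounded_open_set \<Omega>
      by unfold_locales (auto simp: bounded_lipschitz_domain_def)
    assume "time_grid T N t" "max_step N t \<le> 1 / (1 + 2 * C\<^sub>\<psi>)" "y\<^sub>0\<^sub>1 \<in> H1 \<Omega>" "y\<^sub>0\<^sub>2 \<in> H1 \<Omega>"
      "u\<^sub>1 \<in> U_space \<Omega> T N t" "u\<^sub>2 \<in> U_space \<Omega> T N t"
      "S_tau_graph \<Omega> A' \<psi>' T N t y\<^sub>0\<^sub>1 u\<^sub>1 y\<^sub>1" "S_tau_graph \<Omega> A' \<psi>' T N t y\<^sub>0\<^sub>2 u\<^sub>2 y\<^sub>2"
    then show "Linf_time_norm T (\<lambda>s. L2_norm \<Omega> (\<lambda>x. y\<^sub>1 s x - y\<^sub>2 s x))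
         + ereal (L2_time_norm T (\<lambda>s. L2_norm \<Omega> (\<lambda>x. weak_grad \<Omega> (y\<^sub>1 s) x - weak_grad \<Omega> (y\<^sub>2 s) x)))
       \<le> ereal ((K + K / sqrt C\<^sub>A) * (L2_norm \<Omega> (\<lambda>x. y\<^sub>0\<^sub>1 x - y\<^sub>0\<^sub>2 x)
           + L2_time_norm T (\<lambda>s. H1_dual_norm \<Omega> (L2_inner \<Omega> (\<lambda>x. u\<^sub>1 s x - u\<^sub>2 s x)))))"
      by (intro discrete_stability[OF T A_const(1) const(2) A_C1(2) A_growth A_mono \<psi>' _ _ _ _ _ _ _ _ \<delta>_def \<mu>_def K_def])
  qed
qed

end
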